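(* For every small semi-walled wedge there exists a finite deterministic automaton that explores it using one pebble.
   Context: The oriented grid $\mathbb{Z}\times\mathbb{Z}$ is embedded in the plane (nodes at integer points, edges between nodes at distance 1); nodes are anonymous and every node has ports $N,E,S,W$ pointing North, East, South, West. Given two half-lines $H_1,H_2$ in the plane with a common origin $O$ (an arbitrary point; arbitrary real directions), let $W(H_1,H_2)$ be the closed region swept clockwise from $H_1$ to $H_2$ (half-lines included); the wedge is the subgraph of the grid induced by the grid nodes in $W(H_1,H_2)$. It is small if the clockwise angle from $H_1$ to $H_2$ is less than $\pi$. Consider grid edges $\{u,v\}$ with $u$ in the wedge, $v$ not in the wedge and $H_i$ meeting the closed segment $[u,v]$: $H_i$ is a wall if the ports of all such edges at $u$ and $v$ are blocked (cannot be taken), and free if they are free. A wedge is semi-walled if $H_1$ is a wall and $H_2$ is free; all ports other than those blocked by the wall are free (the agent may leave the wedge across $H_2$). The agent is a finite deterministic (Mealy) automaton carrying $p$ pebbles: at each step it sees which ports at the current node are free, whether a pebble lies there, and how many pebbles it carries; depending on its state and this input it moves through a free port, possibly dropping a pebble on the empty current node (if it carries one) or picking up the pebble lying there, and changes state. It starts in its initial state with all $p$ pebbles, no pebbles on the grid, at an adversarially chosen node of the wedge. The automaton (which may depend on $H_1,H_2$ but not on the starting node) explores the wedge if for every starting node every node of the wedge is eventually visited. *)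

theory Defs
  imports "HOL-Analysis.Analysis"
begin

type_synonym node = "int \<times> int"

datatype port = North | East | South | West

fun neighbour :: "node \<Rightarrow> port \<Rightarrow> node" where
  "neighbour (x, y) North = (x, y + 1)"
| "neighbour (x, y) East = (x + 1, y)"
| "neighbour (x, y) South = (x, y - 1)"
| "neighbour (x, y) West = (x - 1, y)"

(* The plane is the type of complex numbers. *)
definition point :: "node \<Rightarrow> complex" where
  "point u = Complex (of_int (fst u)) (of_int (snd u))"

(* The half-line with origin c and (nonzero, not necessarily normalised) direction d. *)
definition half_line :: "complex \<Rightarrow> complex \<Rightarrow> complex set" where
  "half_line c d = {c + of_real t * d |t. t \<ge> 0}"

(* The angle in [0, 2 pi) by which d1 must be turned clockwise to point in the direction of d2.
   It is 0 exactly if d1 and d2 have the same direction. *)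
definition clockwise_angle :: "complex \<Rightarrow> complex \<Rightarrow> real" where
  "clockwise_angle d1 d2 = Arg2pi (d1 / d2)"

(* Multiplication by cis (- phi) is the clockwise rotation by the angle phi. *)
definition wedge_region :: "complex \<Rightarrow> complex \<Rightarrow> complex \<Rightarrow> complex set" where
  "wedge_region c d1 d2 =
     (\<Union>\<phi>\<in>{0..clockwise_angle d1 d2}. half_line c (d1 * cis (- \<phi>)))"

definition wedge :: "complex \<Rightarrow> complex \<Rightarrow> complex \<Rightarrow> node set" where
  "wedge c d1 d2 = {u. point u \<in> wedge_region c d1 d2}"

definition small_wedge :: "complex \<Rightarrow> complex \<Rightarrow> bool" where
  "small_wedge d1 d2 \<longleftrightarrow> clockwise_angle d1 d2 < pi"

(* The grid edges that leave the node set V and meet H; an edge is the set of its two ends. *)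
definition crossing_edges :: "node set \<Rightarrow> complex set \<Rightarrow> node set set" where
  "crossing_edges V H =
     {{u, neighbour u a} |u a. u \<in> V \<and> neighbour u a \<notin> V \<and>
        closed_segment (point u) (point (neighbour u a)) \<inter> H \<noteq> {}}"

(* In the following, F u is the set of the free ports at the node u; all other ports at u are
   blocked. Since edges are unordered, both conditions concern the ports at both ends. *)

definition is_wall :: "(node \<Rightarrow> port set) \<Rightarrow> node set set \<Rightarrow> bool" where
  "is_wall F E \<longleftrightarrow> (\<forall>u a. {u, neighbour u a} \<in> E \<longrightarrow> a \<notin> F u)"

definition is_free :: "(node \<Rightarrow> port set) \<Rightarrow> node set set \<Rightarrow> bool" where
  "is_free F E \<longleftrightarrow> (\<forall>u a. {u, neighbour u a} \<in> E \<longrightarrow> a \<in> F u)"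

(* An edge leaving the wedge may meet both half-lines. In a small wedge with distinct half-lines
   there are only finitely many such edges, all near the origin c. A wall on the first half-line
   and freedom of the second one make conflicting demands on them. They are taken to be free:
   the agent may leave the wedge across the second half-line. Blocking them instead could isolate
   a node of the wedge: for c = 0, d1 = Complex 1 2 and d2 = Complex 1 1 all four edges at the
   node (0, 0) leave the wedge and meet both half-lines. *)
definition semi_walled ::
    "complex \<Rightarrow> complex \<Rightarrow> complex \<Rightarrow> (node \<Rightarrow> port set) \<Rightarrow> bool" where
  "semi_walled c d1 d2 F \<longleftrightarrow>
     (let E1 = crossing_edges (wedge c d1 d2) (half_line c d1);
          E2 = crossing_edges (wedge c d1 d2) (half_line c d2)
      in is_wall F (E1 - E2) \<and> is_free F E2 \<and> is_free F (- (E1 \<union> E2)))"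

datatype pebble_op = Keep | Drop | Pick

(* trans q P b k is the reaction in state q to the free ports P, the presence b of a pebble at
   the current node and the number k of carried pebbles: the new state, what is done with the
   pebbles at the current node, and the port taken afterwards. *)
record 'q automaton =
  states :: "'q set"
  initial :: 'q
  trans :: "'q \<Rightarrow> port set \<Rightarrow> bool \<Rightarrow> nat \<Rightarrow> 'q \<times> pebble_op \<times> port"

(* Deterministic finite automata for an agent with p pebbles, performing legal actions only. *)
definition valid_automaton :: "nat \<Rightarrow> 'q automaton \<Rightarrow> bool" where
  "valid_automaton p A \<longleftrightarrow> finite (states A) \<and> initial A \<in> states A \<and>
     (\<forall>q\<in>states A. \<forall>P b. \<forall>k\<le>p. case trans A q P b k of (q', op, a) \<Rightarrow>
        q' \<in> states A \<and> (P \<noteq> {} \<longrightarrow> a \<in> P) \<and>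
        (op = Drop \<longrightarrow> \<not> b \<and> k > 0) \<and> (op = Pick \<longrightarrow> b))"

record 'q config =
  pos :: node
  state :: 'q
  carried :: nat
  pebbles :: "node set"

(* The agent stays in place only at a node without any free port, where it cannot move. *)
definition step :: "(node \<Rightarrow> port set) \<Rightarrow> 'q automaton \<Rightarrow> 'q config \<Rightarrow> 'q config" where
  "step F A C =
     (let u = pos C;
          (q', op, a) = trans A (state C) (F u) (u \<in> pebbles C) (carried C)
      in \<lparr>pos = (if a \<in> F u then neighbour u a else u),
          state = q',
          carried = (case op of Keep \<Rightarrow> carried C | Drop \<Rightarrow> carried C - 1 | Pick \<Rightarrow> carried C + 1),
          pebbles = (case op of Keep \<Rightarrow> pebbles C
                     | Drop \<Rightarrow> insert u (pebbles C) | Pick \<Rightarrow> pebbles C - {u})\<rparr>)"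

definition initial_config :: "nat \<Rightarrow> 'q automaton \<Rightarrow> node \<Rightarrow> 'q config" where
  "initial_config p A s = \<lparr>pos = s, state = initial A, carried = p, pebbles = {}\<rparr>"

definition explores ::
    "(node \<Rightarrow> port set) \<Rightarrow> node set \<Rightarrow> nat \<Rightarrow> 'q automaton \<Rightarrow> bool" where
  "explores F V p A \<longleftrightarrow>
     (\<forall>s\<in>V. \<forall>v\<in>V. \<exists>n. pos ((step F A ^^ n) (initial_config p A s)) = v)"

end

theory Submission
  imports Defs
begin

text \<open>
  Choose a primitive integer vector \<open>e\<close> in the open cone that follows the second half-line clockwise
  and precedes the prolongation of the first one. The lines of direction \<open>e\<close> through grid nodes are
  numbered; all but finitely many of those that meet the wedge start at the wall, and each of them
  meets the wedge in a bounded segment. Moreover there is a vector \<open>f\<close>, completing \<open>e\<close> to a basis of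
  the grid, that leads to the next line and slightly towards the wall.

  In a round, the automaton drops the pebble at the wall on some line, walks to and fro between the
  pebble and the wall along \<open>e\<close>, moves the pebble by \<open>e - f\<close> to the previous line, and so on until
  a fixed bottom line is reached. There it also tours the finitely many nodes of the wedge on lower
  lines. Then it carries the pebble a bit further along \<open>e\<close> and in direction \<open>f\<close> until it hits the
  wall. As \<open>e - f\<close> leads away from the wall, the new starting line is higher than the previous one,
  so the rounds exhaust the wedge.

  The bottom line is recognized at the wall by means of a fixed path that ends behind the wall. It
  goes round the end of the wall if started on a certain high line, and it is blocked on all
  sufficiently high lines, so the highest line on which it is free can serve as the bottom line.
\<close>

section \<open>Paths in the grid\<close>

fun opp :: "port \<Rightarrow> port" where
  "opp North = South" | "opp East = West" | "opp South = North" | "opp West = East"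

lemma neighbour_opp [simp]: "neighbour (neighbour u a) (opp a) = u"
  by (cases u; cases a) auto

instance port :: countable
  by countable_datatype

instance port :: finite
proof
  have "(UNIV :: port set) = {North, East, South, West}"
    using port.exhaust by auto
  then show "finite (UNIV :: port set)"
    by (metis finite.simps)
qed

abbreviation walk :: "node \<Rightarrow> port list \<Rightarrow> node" where
  "walk \<equiv> foldl neighbour"

fun nodes_on :: "node \<Rightarrow> port list \<Rightarrow> node set" where
  "nodes_on u [] = {u}"
| "nodes_on u (p # ps) = insert u (nodes_on (neighbour u p) ps)"

fun pfree :: "(node \<Rightarrow> port set) \<Rightarrow> node \<Rightarrow> port list \<Rightarrow> bool" where
  "pfree F u [] \<longleftrightarrow> True"
| "pfree F u (p # ps) \<longleftrightarrow> p \<in> F u \<and> pfree F (neighbour u p) ps"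

definition backtrack :: "port list \<Rightarrow> port list" where
  "backtrack ps = rev (map opp ps)"

text \<open>Both ends of an edge agree on whether it is blocked, which is what makes every free path
  walkable backwards.\<close>

definition sym_ports :: "(node \<Rightarrow> port set) \<Rightarrow> bool" where
  "sym_ports F \<longleftrightarrow> (\<forall>u a. a \<in> F u \<longrightarrow> opp a \<in> F (neighbour u a))"

lemma sym_portsD: "sym_ports F \<Longrightarrow> a \<in> F u \<Longrightarrow> opp a \<in> F (neighbour u a)"
  unfolding sym_ports_def by blast

lemma walk_backtrack [simp]: "walk (walk u ps) (backtrack ps) = u"
  by (induction ps arbitrary: u) (auto simp: backtrack_def)

lemma pfree_append [simp]: "pfree F u (ps @ qs) \<longleftrightarrow> pfree F u ps \<and> pfree F (walk u ps) qs"
  by (induction ps arbitrary: u) auto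

lemma pfree_backtrack:
  assumes "sym_ports F" and "pfree F u ps"
  shows "pfree F (walk u ps) (backtrack ps)"
  using assms(2)
proof (induction ps arbitrary: u)
  case (Cons p ps)
  then have "opp p \<in> F (neighbour u p)"
    using assms(1) by (simp add: sym_portsD)
  moreover have "walk (walk (neighbour u p) ps) (backtrack ps) = neighbour u p"
    by simp
  ultimately show ?case
    using Cons by (simp add: backtrack_def)
qed (simp add: backtrack_def)

lemma nodes_on_append [simp]: "nodes_on u (ps @ qs) = nodes_on u ps \<union> nodes_on (walk u ps) qs"
proof (induction ps arbitrary: u)
  case Nil
  show ?case by (cases qs) auto
qed auto

lemma start_in_nodes_on [simp]: "u \<in> nodes_on u ps"
  by (cases ps) auto

lemma end_in_nodes_on [simp]: "walk u ps \<in> nodes_on u ps"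
  by (induction ps arbitrary: u) auto

lemma nodes_on_walk:
  assumes "v \<in> nodes_on u ps"
  obtains k where "k \<le> length ps" and "v = walk u (take k ps)"
  using assms
proof (induction ps arbitrary: u thesis)
  case (Cons p ps)
  show ?case
  proof (cases "v = u")
    case True
    then show ?thesis using Cons.prems(1)[of 0] by simp
  next
    case False
    then obtain k where "k \<le> length ps" "v = walk (neighbour u p) (take k ps)"
      using Cons.IH[of "neighbour u p"] Cons.prems(2) by auto
    then show ?thesis using Cons.prems(1)[of "Suc k"] by simp
  qed
qed auto

lemma not_pfree_first:
  assumes "\<not> pfree F u ps"
  obtains k where "k < length ps" and "pfree F u (take k ps)" and "ps ! k \<notin> F (walk u (take k ps))"
  using assms
proof (induction ps arbitrary: u thesis)
  case (Cons p ps)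
  show ?case
  proof (cases "p \<in> F u")
    case True
    then obtain k where "k < length ps" "pfree F (neighbour u p) (take k ps)"
        "ps ! k \<notin> F (walk (neighbour u p) (take k ps))"
      using Cons.IH[of "neighbour u p"] Cons.prems(2) by auto
    then show ?thesis using Cons.prems(1)[of "Suc k"] True by simp
  next
    case False
    then show ?thesis using Cons.prems(1)[of 0] by simp
  qed
qed auto

text \<open>The reverse of the last step is free. A free port is needed wherever the agent reacts
  without moving, since it leaves and returns through one.\<close>

lemma walk_free_nonempty:
  assumes "sym_ports F" and "F u \<noteq> {}" and "pfree F u ps"
  shows "F (walk u ps) \<noteq> {}"
  using assms(2,3)
proof (induction ps arbitrary: u)
  case (Cons p ps)
  then have "opp p \<in> F (neighbour u p)"
    using assms(1) by (simp add: sym_portsD)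
  then have "F (neighbour u p) \<noteq> {}"
    by blast
  then show ?case using Cons.IH[of "neighbour u p"] Cons.prems by simp
qed simp

section \<open>Automata that follow paths\<close>

text \<open>The result asks for natural numbers as states, whereas programs have structured states;
  these are renamed along the injection \<open>to_nat\<close>.\<close>

definition encode :: "'q::countable automaton \<Rightarrow> nat automaton" where
  "encode A = \<lparr>states = to_nat ` states A, initial = to_nat (initial A),
     trans = (\<lambda>q P b k. case trans A (from_nat q) P b k of (q', op, a) \<Rightarrow> (to_nat q', op, a))\<rparr>"

lemma valid_encode: "valid_automaton p A \<Longrightarrow> valid_automaton p (encode A)"
  unfolding valid_automaton_def encode_def
  by (auto simp: case_prod_beta)

lemma explores_encode:
  assumes "explores F V p A"
  shows "explores F V p (encode A)"
proof -
  \<comment> \<open>Renaming the state of a configuration commutes with \<open>step\<close>, so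
    corresponding runs have the same positions.\<close>
  define h :: "'a config \<Rightarrow> nat config" where
    "h C = \<lparr>pos = pos C, state = to_nat (state C), carried = carried C, pebbles = pebbles C\<rparr>" for C
  have "step F (encode A) (h C) = h (step F A C)" for C
    by (simp add: step_def h_def encode_def Let_def split: prod.split pebble_op.split)
  then have "(step F (encode A) ^^ n) (h C) = h ((step F A ^^ n) C)" for n C
    by (induction n) auto
  then have "pos ((step F (encode A) ^^ n) (h C)) = pos ((step F A ^^ n) C)" for n C
    by (simp add: h_def)
  moreover have "initial_config p (encode A) s = h (initial_config p A s)" for s
    by (simp add: initial_config_def h_def encode_def)
  ultimately show ?thesis
    using assms by (simp add: explores_def)
qed

text \<open>\<open>Try\<close> follows its path and continues at the first label; if some port on
  the way is blocked, it returns to its starting node and continues at the second label.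
  \<open>Test\<close> branches on the presence of a pebble.\<close>

datatype instr =
  Try "port list" nat nat
| Put nat
| Take nat
| Test nat nat

text \<open>
  A state \<open>(l, k, d)\<close> belongs to the instruction with number \<open>l\<close>; while a path is tried, \<open>k\<close> of its
  steps are done, and \<open>d\<close> tells whether to proceed or to go back. A reaction without a move is
  simulated by leaving the node through any free port and returning.
\<close>

fun decide :: "instr \<Rightarrow> nat \<times> nat \<times> bool \<Rightarrow> port set \<Rightarrow> bool \<Rightarrow> nat
    \<Rightarrow> (nat \<times> nat \<times> bool) \<times> pebble_op \<times> port option" where
  "decide (Try ps l1 l2) (l, k, True) P b c =
     (if length ps \<le> k then ((l1, 0, True), Keep, None)
      else if ps ! k \<in> P then ((l, Suc k, True), Keep, Some (ps ! k))
      else ((l, k, False), Keep, None))"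
| "decide (Try ps l1 l2) (l, 0, False) P b c = ((l2, 0, True), Keep, None)"
| "decide (Try ps l1 l2) (l, Suc k, False) P b c = ((l, k, False), Keep, Some (opp (ps ! k)))"
| "decide (Put l1) q P b c = ((l1, 0, True), if \<not> b \<and> c > 0 then Drop else Keep, None)"
| "decide (Take l1) q P b c = ((l1, 0, True), if b then Pick else Keep, None)"
| "decide (Test l1 l2) q P b c = ((if b then l1 else l2, 0, True), Keep, None)"

text \<open>Validity concerns every state and every input, including those that never arise in a
  run; there an arbitrary free port serves as default.\<close>

definition legal :: "port set \<Rightarrow> port \<Rightarrow> port" where
  "legal P a = (if a \<in> P then a else SOME a. a \<in> P)"

lemma legal_in: "P \<noteq> {} \<Longrightarrow> legal P a \<in> P"
  by (simp add: legal_def some_in_eq)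

text \<open>The second component of the state remembers the port that leads back from a detour; it
  is \<open>None\<close> when the program itself reacts.\<close>

fun prog_trans :: "instr list \<Rightarrow> (nat \<times> nat \<times> bool) \<times> port option \<Rightarrow> port set \<Rightarrow> bool \<Rightarrow> nat
    \<Rightarrow> ((nat \<times> nat \<times> bool) \<times> port option) \<times> pebble_op \<times> port" where
  "prog_trans prog (q, Some a) P b c = ((q, None), Keep, legal P a)"
| "prog_trans prog (q, None) P b c =
     (case decide (prog ! fst q) q P b c of
        (q', op, Some a) \<Rightarrow> ((q', None), op, legal P a)
      | (q', op, None) \<Rightarrow> (let a = legal P North in ((q', Some (opp a)), op, a)))"

fun path_of :: "instr \<Rightarrow> port list" where
  "path_of (Try ps l1 l2) = ps"
| "path_of _ = []"

fun targets :: "instr \<Rightarrow> nat set" where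
  "targets (Try ps l1 l2) = {l1, l2}"
| "targets (Put l1) = {l1}"
| "targets (Take l1) = {l1}"
| "targets (Test l1 l2) = {l1, l2}"

text \<open>The total length of all paths is a common bound for the step counter and keeps the state
  set finite.\<close>

definition machine :: "instr list \<Rightarrow> ((nat \<times> nat \<times> bool) \<times> port option) automaton" where
  "machine prog =
     \<lparr>states = ({..<length prog} \<times> {..sum_list (map (length \<circ> path_of) prog)} \<times> UNIV) \<times> UNIV,
      initial = ((0, 0, True), None), trans = prog_trans prog\<rparr>"

lemma decide_target:
  assumes "decide i (l, k, d) P b c = ((l', k', d'), op, m)" and "k \<le> n" and "length (path_of i) \<le> n"
  shows "l' \<in> insert l (targets i)" and "k' \<le> n" and "op = Drop \<Longrightarrow> \<not> b \<and> c > 0" and "op = Pick \<Longrightarrow> b"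
proof -
  have "(l' \<in> insert l (targets i)) \<and> k' \<le> n \<and> (op = Drop \<longrightarrow> \<not> b \<and> c > 0) \<and> (op = Pick \<longrightarrow> b)"
    using assms by (cases i; cases d; cases k) (auto split: if_splits simp: Suc_le_eq intro: less_le_trans[of 0 "length _"])
  then show "l' \<in> insert l (targets i)" and "k' \<le> n" and "op = Drop \<Longrightarrow> \<not> b \<and> c > 0" and "op = Pick \<Longrightarrow> b"
    by auto
qed

lemma valid_machine:
  assumes "prog \<noteq> []" and "\<And>i. i \<in> set prog \<Longrightarrow> targets i \<subseteq> {..<length prog}"
  shows "valid_automaton p (machine prog)"
proof -
  define n where "n = sum_list (map (length \<circ> path_of) prog)"
  have len: "length (path_of (prog ! l)) \<le> n" if "l < length prog" for l
    unfolding n_def using that by (intro member_le_sum_list) auto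
  have reaction: "case prog_trans prog q P b c of (q', op, a) \<Rightarrow>
        q' \<in> ({..<length prog} \<times> {..n} \<times> UNIV) \<times> UNIV \<and> (P \<noteq> {} \<longrightarrow> a \<in> P) \<and>
        (op = Drop \<longrightarrow> \<not> b \<and> c > 0) \<and> (op = Pick \<longrightarrow> b)"
    if q: "q \<in> ({..<length prog} \<times> {..n} \<times> UNIV) \<times> UNIV" for q P b c
  proof -
    obtain l k d r where q_eq: "q = ((l, k, d), r)" and l: "l < length prog" and k: "k \<le> n"
      using q by (cases q) auto
    show ?thesis
    proof (cases r)
      case (Some a)
      then show ?thesis using q_eq l k by (simp add: legal_in)
    next
      case None
      obtain s op m where s: "decide (prog ! l) (l, k, d) P b c = (s, op, m)"
        by (rule prod_cases3)
      obtain l' k' d' where "s = (l', k', d')"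
        by (rule prod_cases3)
      then have dec: "decide (prog ! l) (l, k, d) P b c = ((l', k', d'), op, m)"
        using s by simp
      note t = decide_target[OF dec k len[OF l]]
      have "l' < length prog"
        using t(1) l assms(2)[of "prog ! l"] by auto
      then show ?thesis
        using t q_eq None dec by (cases m) (auto simp: legal_in Let_def)
    qed
  qed
  have "\<forall>q\<in>states (machine prog). \<forall>P b. \<forall>c\<le>p. case trans (machine prog) q P b c of (q', op, a) \<Rightarrow>
        q' \<in> states (machine prog) \<and> (P \<noteq> {} \<longrightarrow> a \<in> P) \<and>
        (op = Drop \<longrightarrow> \<not> b \<and> c > 0) \<and> (op = Pick \<longrightarrow> b)"
    unfolding machine_def automaton.simps n_def[symmetric]
    by (intro ballI allI impI) (rule reaction)
  moreover have "finite (states (machine prog))"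
    by (simp add: machine_def)
  moreover have "initial (machine prog) \<in> states (machine prog)"
    using assms(1) by (simp add: machine_def)
  ultimately show ?thesis
    unfolding valid_automaton_def by blast
qed

section \<open>Runs of a machine, instruction by instruction\<close>

definition conf :: "node \<Rightarrow> nat \<times> nat \<times> bool \<Rightarrow> nat \<Rightarrow> node set
    \<Rightarrow> ((nat \<times> nat \<times> bool) \<times> port option) config" where
  "conf u q c B = \<lparr>pos = u, state = (q, None), carried = c, pebbles = B\<rparr>"

abbreviation at_label :: "node \<Rightarrow> nat \<Rightarrow> nat \<Rightarrow> node set
    \<Rightarrow> ((nat \<times> nat \<times> bool) \<times> port option) config" where
  "at_label u l c B \<equiv> conf u (l, 0, True) c B"

lemma pos_conf [simp]: "pos (conf u q c B) = u"
  by (simp add: conf_def)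

locale program =
  fixes F :: "node \<Rightarrow> port set" and prog :: "instr list"
  assumes sym: "sym_ports F"
begin

definition reach (infix "\<leadsto>" 50) where
  "C \<leadsto> C' \<longleftrightarrow> (\<exists>n. (step F (machine prog) ^^ n) C = C')"

definition visits where
  "visits C v \<longleftrightarrow> (\<exists>C'. C \<leadsto> C' \<and> pos C' = v)"

lemma reach_refl [simp]: "C \<leadsto> C"
  unfolding reach_def by (rule exI[of _ 0]) simp

lemma reach_step: "C \<leadsto> step F (machine prog) C"
  unfolding reach_def by (rule exI[of _ 1]) simp

lemma reach_trans [trans]: "C \<leadsto> C' \<Longrightarrow> C' \<leadsto> C'' \<Longrightarrow> C \<leadsto> C''"
  unfolding reach_def by (metis funpow_add o_apply)

lemma visits_here: "C \<leadsto> conf u q c B \<Longrightarrow> visits C u"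
  unfolding visits_def by (metis pos_conf)

lemma visits_later: "C \<leadsto> C' \<Longrightarrow> visits C' v \<Longrightarrow> visits C v"
  unfolding visits_def using reach_trans by blast

text \<open>Two steps of the automaton: it handles the pebble while leaving through a free port, and
  symmetry of \<open>F\<close> lets it come straight back.\<close>

lemma reach_stay:
  assumes "decide (prog ! l) (l, k, d) (F u) (u \<in> B) c = (q, op, None)" and "F u \<noteq> {}"
  shows "conf u (l, k, d) c B \<leadsto> conf u q
    (case op of Keep \<Rightarrow> c | Drop \<Rightarrow> c - 1 | Pick \<Rightarrow> c + 1)
    (case op of Keep \<Rightarrow> B | Drop \<Rightarrow> insert u B | Pick \<Rightarrow> B - {u})"
proof -
  define a where "a = legal (F u) North"
  have a: "a \<in> F u"
    using assms(2) legal_in a_def by simp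
  then have "opp a \<in> F (neighbour u a)"
    using sym by (rule sym_portsD[rotated])
  then have "step F (machine prog) (step F (machine prog) (conf u (l, k, d) c B)) = conf u q
    (case op of Keep \<Rightarrow> c | Drop \<Rightarrow> c - 1 | Pick \<Rightarrow> c + 1)
    (case op of Keep \<Rightarrow> B | Drop \<Rightarrow> insert u B | Pick \<Rightarrow> B - {u})"
    using a assms(1)
    by (simp add: step_def conf_def machine_def Let_def a_def[symmetric] legal_def[of "F (neighbour u a)"]
        split: pebble_op.split)
  then show ?thesis
    by (metis reach_step reach_trans)
qed

lemma reach_move:
  assumes "decide (prog ! l) (l, k, d) (F u) (u \<in> B) c = (q, Keep, Some a)" and "a \<in> F u"
  shows "conf u (l, k, d) c B \<leadsto> conf (neighbour u a) q c B"
proof -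
  have "step F (machine prog) (conf u (l, k, d) c B) = conf (neighbour u a) q c B"
    using assms by (simp add: step_def conf_def machine_def legal_def)
  then show ?thesis
    by (metis reach_step)
qed

lemma reach_forward:
  assumes "prog ! l = Try ps l1 l2" and "pfree F u (take k ps)" and "k \<le> length ps"
  shows "at_label u l c B \<leadsto> conf (walk u (take k ps)) (l, k, True) c B"
  using assms(2,3)
proof (induction k)
  case (Suc k)
  have t: "take (Suc k) ps = take k ps @ [ps ! k]"
    using Suc.prems by (simp add: take_Suc_conv_app_nth)
  have "at_label u l c B \<leadsto> conf (walk u (take k ps)) (l, k, True) c B"
    using Suc t by simp
  also have "\<dots> \<leadsto> conf (neighbour (walk u (take k ps)) (ps ! k)) (l, Suc k, True) c B"
    using Suc.prems t assms(1) by (intro reach_move) auto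
  finally show ?case
    using t by simp
qed simp

lemma reach_backward:
  assumes "prog ! l = Try ps l1 l2" and "pfree F u (take k ps)" and "k \<le> length ps"
  shows "conf (walk u (take k ps)) (l, k, False) c B \<leadsto> conf u (l, 0, False) c B"
  using assms(2,3)
proof (induction k)
  case (Suc k)
  have t: "take (Suc k) ps = take k ps @ [ps ! k]"
    using Suc.prems by (simp add: take_Suc_conv_app_nth)
  have "opp (ps ! k) \<in> F (neighbour (walk u (take k ps)) (ps ! k))"
    using sym Suc.prems t by (simp add: sym_portsD)
  then have "conf (walk u (take (Suc k) ps)) (l, Suc k, False) c B
      \<leadsto> conf (neighbour (walk u (take (Suc k) ps)) (opp (ps ! k))) (l, k, False) c B"
    using t assms(1) by (intro reach_move) auto
  also have "\<dots> \<leadsto> conf u (l, 0, False) c B"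
    using Suc t by simp
  finally show ?case .
qed simp

lemma try_free:
  assumes "prog ! l = Try ps l1 l2" and "pfree F u ps" and "F u \<noteq> {}"
  shows "at_label u l c B \<leadsto> at_label (walk u ps) l1 c B"
proof -
  have "at_label u l c B \<leadsto> conf (walk u ps) (l, length ps, True) c B"
    using reach_forward[of l ps l1 l2 u "length ps" c B] assms by simp
  also have "\<dots> \<leadsto> at_label (walk u ps) l1 c B"
    using reach_stay[of l "length ps" True "walk u ps" B c] assms walk_free_nonempty[OF sym] by simp
  finally show ?thesis .
qed

text \<open>The agent advances to the first blocked port and then retraces the free part of the
  path.\<close>

lemma try_blocked:
  assumes "prog ! l = Try ps l1 l2" and "\<not> pfree F u ps" and "F u \<noteq> {}"
  shows "at_label u l c B \<leadsto> at_label u l2 c B"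
proof -
  obtain k where k: "k < length ps" "pfree F u (take k ps)" "ps ! k \<notin> F (walk u (take k ps))"
    using not_pfree_first[OF assms(2)] .
  have "at_label u l c B \<leadsto> conf (walk u (take k ps)) (l, k, True) c B"
    using k assms(1) by (intro reach_forward) auto
  also have "\<dots> \<leadsto> conf (walk u (take k ps)) (l, k, False) c B"
    using reach_stay[of l k True "walk u (take k ps)" B c] assms k walk_free_nonempty[OF sym] by simp
  also have "\<dots> \<leadsto> conf u (l, 0, False) c B"
    using k assms(1) by (intro reach_backward) auto
  also have "\<dots> \<leadsto> at_label u l2 c B"
    using reach_stay[of l 0 False u B c] assms by simp
  finally show ?thesis .
qed

lemma try_visits:
  assumes "prog ! l = Try ps l1 l2" and "pfree F u ps" and "v \<in> nodes_on u ps"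
  shows "visits (at_label u l c B) v"
proof -
  obtain k where k: "k \<le> length ps" "v = walk u (take k ps)"
    using nodes_on_walk[OF assms(3)] .
  have "pfree F u (take k ps @ drop k ps)"
    using assms(2) by simp
  then have "pfree F u (take k ps)"
    by (simp only: pfree_append)
  then show ?thesis
    using visits_here reach_forward[OF assms(1) _ k(1)] k(2) by blast
qed

lemma put:
  assumes "prog ! l = Put l1" and "u \<notin> B" and "c > 0" and "F u \<noteq> {}"
  shows "at_label u l c B \<leadsto> at_label u l1 (c - 1) (insert u B)"
  using reach_stay[of l 0 True u B c] assms by simp

lemma take_up:
  assumes "prog ! l = Take l1" and "u \<in> B" and "F u \<noteq> {}"
  shows "at_label u l c B \<leadsto> at_label u l1 (c + 1) (B - {u})"
  using reach_stay[of l 0 True u B c] assms by simp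

lemma test:
  assumes "prog ! l = Test l1 l2" and "F u \<noteq> {}"
  shows "at_label u l c B \<leadsto> at_label u (if u \<in> B then l1 else l2) c B"
  using reach_stay[of l 0 True u B c] assms by simp

end

section \<open>Scanning a wedge line by line\<close>

text \<open>Labels 0 and 1 walk outward and climb to the wall, 2 drops the pebble, 3 returns to the
  wall and 4 probes for the bottom line. On the bottom line, 5 makes the tour, 6 and 8 seek the
  pebble, and 9 takes it and starts a new round. On other lines, 7 and 10 seek the pebble, 11 takes
  it and 12 carries it to the previous line.\<close>

definition scan_prog :: "port list \<Rightarrow> port list \<Rightarrow> port list \<Rightarrow> port list \<Rightarrow> port list \<Rightarrow> port list
    \<Rightarrow> nat \<Rightarrow> instr list" where
  "scan_prog outward inward up down probe tour K =
    [Try (concat (replicate K outward)) 1 1,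
     Try up 1 2,
     Put 3,
     Try inward 3 4,
     Try probe 5 7,
     Try (backtrack probe @ tour) 6 6,
     Test 9 8,
     Test 11 10,
     Try outward 6 6,
     Take 0,
     Try outward 7 7,
     Take 12,
     Try (outward @ down) 2 2]"

lemma valid_scan_prog: "valid_automaton p (machine (scan_prog outward inward up down probe tour K))"
  by (rule valid_machine) (auto simp: scan_prog_def)

text \<open>\<open>P i j\<close> stands for the node with index \<open>i\<close>, counted from the
  wall, on line \<open>j\<close>; going up to the next line changes the index by
  \<open>\<delta> j\<close>. Lines are unbounded outward, since the agent may leave the wedge across
  the second half-line. \<open>rank\<close> bounds the length of a climb, and \<open>K\<close>
  outward steps make up for starting below the bottom line.\<close>

locale scan = program F "scan_prog outward inward up down probe tour K"
  for F :: "node \<Rightarrow> port set" and outward inward up down probe tour :: "port list" and K :: nat +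
  fixes P :: "int \<Rightarrow> int \<Rightarrow> node" and \<delta> :: "int \<Rightarrow> int" and bottom :: int
    and rank :: "int \<Rightarrow> int \<Rightarrow> nat"
  assumes P_inj: "P i j = P i' j \<Longrightarrow> i = i'"
    and delta: "\<delta> j = 0 \<or> \<delta> j = - 1"
    and walk_outward: "walk (P i j) outward = P (i + 1) j"
    and walk_inward: "walk (P i j) inward = P (i - 1) j"
    and walk_up: "walk (P i j) up = P (i + \<delta> j) (j + 1)"
    and walk_down: "walk (P i (j + 1)) down = P (i - \<delta> j) j"
    and walk_tour: "walk (P 0 bottom) tour = P 0 bottom"
    and outward_nonempty: "outward \<noteq> []"
    and outward_free: "0 \<le> i \<Longrightarrow> pfree F (P i j) outward"
    and inward_free: "1 \<le> i \<Longrightarrow> pfree F (P i j) inward"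
    and inward_blocked: "bottom \<le> j \<Longrightarrow> \<not> pfree F (P 0 j) inward"
    and up_free: "0 \<le> i \<Longrightarrow> 0 \<le> i + \<delta> j \<Longrightarrow> pfree F (P i j) up"
    and up_blocked: "bottom \<le> j \<Longrightarrow> \<delta> j = - 1 \<Longrightarrow> \<not> pfree F (P 0 j) up"
    and down_free: "0 \<le> i \<Longrightarrow> pfree F (P i j) down"
    and probe_bottom: "bottom \<le> j \<Longrightarrow> pfree F (P 0 j) probe \<longleftrightarrow> j = bottom"
    and tour_free: "pfree F (P 0 bottom) tour"
    and K_pos: "0 < K"
    and rank_up: "0 \<le> i \<Longrightarrow> 0 \<le> i + \<delta> j \<Longrightarrow> rank (i + \<delta> j) (j + 1) < rank i j"
begin

abbreviation reach_scan (infix "\<leadsto>" 50) where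
  "reach_scan \<equiv> reach"

abbreviation "pr \<equiv> scan_prog outward inward up down probe tour K"

lemma pr_nth:
  "pr ! 0 = Try (concat (replicate K outward)) 1 1"
  "pr ! 1 = Try up 1 2"
  "pr ! 2 = Put 3"
  "pr ! 3 = Try inward 3 4"
  "pr ! 4 = Try probe 5 7"
  "pr ! 5 = Try (backtrack probe @ tour) 6 6"
  "pr ! 6 = Test 9 8"
  "pr ! 7 = Test 11 10"
  "pr ! 8 = Try outward 6 6"
  "pr ! 9 = Take 0"
  "pr ! 10 = Try outward 7 7"
  "pr ! 11 = Take 12"
  "pr ! 12 = Try (outward @ down) 2 2"
  by (simp_all add: scan_prog_def)

lemma ports_nonempty: "0 \<le> i \<Longrightarrow> F (P i j) \<noteq> {}"
  using outward_free[of i j] outward_nonempty by (cases outward) auto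

section \<open>The phases of a single round\<close>

lemma outward_iterate:
  "0 \<le> i \<Longrightarrow> pfree F (P i j) (concat (replicate k outward)) \<and>
     walk (P i j) (concat (replicate k outward)) = P (i + int k) j"
proof (induction k arbitrary: i)
  case (Suc k)
  then show ?case
    using Suc.IH[of "i + 1"] by (simp add: outward_free walk_outward algebra_simps)
qed simp

text \<open>A step up raises \<open>j\<close> by one and lowers \<open>i\<close> by at most one, so
  \<open>j + i\<close> never decreases. The climb can only stop at index 0, hence on a line not
  below the initial \<open>j + i\<close>, where the wall is known to block.\<close>

lemma climb:
  "0 \<le> i \<Longrightarrow> bottom \<le> j + i \<Longrightarrow>
    \<exists>j'\<ge>j + i. at_label (P i j) 1 c B \<leadsto> at_label (P 0 j') 2 c B"
proof (induction "rank i j" arbitrary: i j rule: less_induct)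
  case less
  show ?case
  proof (cases "0 \<le> i + \<delta> j")
    case True
    have "at_label (P i j) 1 c B \<leadsto> at_label (P (i + \<delta> j) (j + 1)) 1 c B"
      using try_free[OF pr_nth(2)] up_free[OF less.prems(1) True] ports_nonempty[OF less.prems(1)]
        walk_up by metis
    moreover have "bottom \<le> (j + 1) + (i + \<delta> j)"
      using less.prems delta[of j] by auto
    then obtain j' where "j' \<ge> (j + 1) + (i + \<delta> j)"
        "at_label (P (i + \<delta> j) (j + 1)) 1 c B \<leadsto> at_label (P 0 j') 2 c B"
      using less.hyps[OF rank_up[OF less.prems(1) True] True] by auto
    ultimately show ?thesis
      using delta[of j] reach_trans by (intro exI[of _ j']) auto
  next
    case False
    then have i: "i = 0" and "\<delta> j = - 1"
      using less.prems delta[of j] by auto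
    then have "\<not> pfree F (P 0 j) up"
      using up_blocked less.prems by simp
    then have "at_label (P 0 j) 1 c B \<leadsto> at_label (P 0 j) 2 c B"
      using try_blocked[OF pr_nth(2)] ports_nonempty by blast
    then show ?thesis
      using i by auto
  qed
qed

lemma departure:
  assumes "0 \<le> i" and "bottom \<le> j + i + int K"
  shows "\<exists>j'\<ge>j + i + int K. at_label (P i j) 0 c B \<leadsto> at_label (P 0 j') 2 c B"
proof -
  have "at_label (P i j) 0 c B \<leadsto> at_label (P (i + int K) j) 1 c B"
    using try_free[OF pr_nth(1), of "P i j"] outward_iterate[OF assms(1), of j K] ports_nonempty[OF assms(1)]
    by simp
  moreover obtain j' where "j' \<ge> j + (i + int K)"
      "at_label (P (i + int K) j) 1 c B \<leadsto> at_label (P 0 j') 2 c B"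
    using climb[of "i + int K" j] assms by auto
  ultimately show ?thesis
    using reach_trans by (intro exI[of _ j']) auto
qed

lemma return_to_wall:
  "bottom \<le> j \<Longrightarrow> at_label (P (int k) j) 3 c B \<leadsto> at_label (P 0 j) 4 c B"
proof (induction k)
  case 0
  then show ?case
    using try_blocked[OF pr_nth(4)] inward_blocked ports_nonempty by simp
next
  case (Suc k)
  have "at_label (P (int (Suc k)) j) 3 c B \<leadsto> at_label (P (int k) j) 3 c B"
    using try_free[OF pr_nth(4), of "P (int (Suc k)) j"] inward_free[of "int (Suc k)" j]
      ports_nonempty[of "int (Suc k)" j] walk_inward[of "int (Suc k)" j] by simp
  then show ?case
    using Suc reach_trans by blast
qed

lemma return_visits:
  assumes "k \<le> n"
  shows "visits (at_label (P (int n) j) 3 c B) (P (int k) j)"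
proof -
  have "at_label (P (int (k + m)) j) 3 c B \<leadsto> at_label (P (int k) j) 3 c B" for m
  proof (induction m)
    case (Suc m)
    have "at_label (P (int (k + Suc m)) j) 3 c B \<leadsto> at_label (P (int (k + m)) j) 3 c B"
      using try_free[OF pr_nth(4), of "P (int (k + Suc m)) j"] inward_free[of "int (k + Suc m)" j]
        ports_nonempty[of "int (k + Suc m)" j] walk_inward[of "int (k + Suc m)" j] by simp
    then show ?case
      using Suc reach_trans by blast
  qed simp
  from this[of "n - k"] show ?thesis
    using assms visits_here by simp
qed

text \<open>Serves both search loops of the program. Distinct indices give distinct nodes, so the
  agent cannot stop before the pebble.\<close>

lemma seek_pebble:
  assumes "pr ! l = Test l1 l2" and "pr ! l2 = Try outward l l"
  shows "k \<le> n \<Longrightarrow> at_label (P (int (n - k)) j) l c {P (int n) j} \<leadsto> at_label (P (int n) j) l1 c {P (int n) j}"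
proof (induction k)
  case 0
  then show ?case
    using test[OF assms(1), of "P (int n) j" c "{P (int n) j}"] ports_nonempty by simp
next
  case (Suc k)
  define i where "i = n - Suc k"
  have "P (int i) j \<noteq> P (int n) j"
    using P_inj[of "int i" j "int n"] Suc.prems i_def by auto
  then have "at_label (P (int i) j) l c {P (int n) j} \<leadsto> at_label (P (int i) j) l2 c {P (int n) j}"
    using test[OF assms(1), of "P (int i) j" c "{P (int n) j}"] ports_nonempty by simp
  also have "\<dots> \<leadsto> at_label (P (int i + 1) j) l c {P (int n) j}"
    using try_free[OF assms(2), of "P (int i) j"] outward_free ports_nonempty walk_outward by simp
  also have "int i + 1 = int (n - k)"
    using Suc.prems i_def by auto
  also have "at_label (P (int (n - k)) j) l c {P (int n) j} \<leadsto> at_label (P (int n) j) l1 c {P (int n) j}"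
    using Suc by simp
  finally show ?case
    by (simp add: i_def)
qed

lemma drop_pebble: "at_label (P (int n) j) 2 1 {} \<leadsto> at_label (P (int n) j) 3 0 {P (int n) j}"
  using put[OF pr_nth(3), of "P (int n) j" "{}" 1] ports_nonempty by simp

lemma line_visits: "k \<le> n \<Longrightarrow> visits (at_label (P (int n) j) 2 1 {}) (P (int k) j)"
  using drop_pebble return_visits visits_later by blast

text \<open>The pebble is carried one step outward and then down. As \<open>\<delta>\<close> is
  never positive, its index grows by at least one with every line.\<close>

lemma descend:
  assumes "bottom < j"
  shows "\<exists>n'>n. at_label (P (int n) j) 2 1 {} \<leadsto> at_label (P (int n') (j - 1)) 2 1 {}"
proof -
  let ?B = "{P (int n) j}"
  have "at_label (P (int n) j) 2 1 {} \<leadsto> at_label (P (int n) j) 3 0 ?B"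
    by (rule drop_pebble)
  also have "\<dots> \<leadsto> at_label (P 0 j) 4 0 ?B"
    using return_to_wall assms by simp
  also have "\<dots> \<leadsto> at_label (P 0 j) 7 0 ?B"
    using try_blocked[OF pr_nth(5)] probe_bottom[of j] assms ports_nonempty by simp
  also have "\<dots> \<leadsto> at_label (P (int n) j) 11 0 ?B"
    using seek_pebble[OF pr_nth(8,11), of n n] by simp
  also have "\<dots> \<leadsto> at_label (P (int n) j) 12 1 {}"
    using take_up[OF pr_nth(12), of "P (int n) j" ?B 0] ports_nonempty by simp
  also have "\<dots> \<leadsto> at_label (P (int n + 1 - \<delta> (j - 1)) (j - 1)) 2 1 {}"
    using try_free[OF pr_nth(13), of "P (int n) j"] outward_free ports_nonempty walk_outward down_free
      walk_down[of "int n + 1" "j - 1"] by simp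
  finally have "at_label (P (int n) j) 2 1 {} \<leadsto> at_label (P (int n + 1 - \<delta> (j - 1)) (j - 1)) 2 1 {}" .
  moreover have "int n + 1 - \<delta> (j - 1) = int (nat (int n + 1 - \<delta> (j - 1)))"
    using delta[of "j - 1"] by auto
  moreover have "nat (int n + 1 - \<delta> (j - 1)) > n"
    using delta[of "j - 1"] by auto
  ultimately show ?thesis
    by metis
qed

lemma bottom_tour: "at_label (P (int n) bottom) 2 1 {} \<leadsto> at_label (P 0 bottom) 4 0 {P (int n) bottom}"
  "at_label (P 0 bottom) 4 c B \<leadsto> at_label (walk (P 0 bottom) probe) 5 c B"
  using drop_pebble return_to_wall reach_trans
   apply blast
  using try_free[OF pr_nth(5)] probe_bottom[of bottom] ports_nonempty by simp

text \<open>On the bottom line the agent stands at the far end of \<open>probe\<close>, so it has to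
  retrace the probe before the tour.\<close>

lemma tour_path_free:
  "pfree F (walk (P 0 bottom) probe) (backtrack probe @ tour)" "F (walk (P 0 bottom) probe) \<noteq> {}"
  using probe_bottom[of bottom] pfree_backtrack[OF sym] tour_free walk_free_nonempty[OF sym]
    ports_nonempty by simp_all

lemma restart: "at_label (P (int n) bottom) 2 1 {} \<leadsto> at_label (P (int n) bottom) 0 1 {}"
proof -
  let ?B = "{P (int n) bottom}"
  have "at_label (P (int n) bottom) 2 1 {} \<leadsto> at_label (P 0 bottom) 4 0 ?B"
    by (rule bottom_tour)
  also have "\<dots> \<leadsto> at_label (walk (P 0 bottom) probe) 5 0 ?B"
    by (rule bottom_tour)
  also have "\<dots> \<leadsto> at_label (P 0 bottom) 6 0 ?B"
    using try_free[OF pr_nth(6) tour_path_free] walk_tour by simp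
  also have "\<dots> \<leadsto> at_label (P (int n) bottom) 9 0 ?B"
    using seek_pebble[OF pr_nth(7,9), of n n] by simp
  also have "\<dots> \<leadsto> at_label (P (int n) bottom) 0 1 {}"
    using take_up[OF pr_nth(10), of "P (int n) bottom" ?B 0] ports_nonempty by simp
  finally show ?thesis .
qed

lemma tour_visits:
  assumes "v \<in> nodes_on (P 0 bottom) tour"
  shows "visits (at_label (P (int n) bottom) 2 1 {}) v"
proof -
  have "visits (at_label (walk (P 0 bottom) probe) 5 0 {P (int n) bottom}) v"
    using try_visits[OF pr_nth(6) tour_path_free(1)] assms by simp
  then show ?thesis
    using bottom_tour visits_later by blast
qed

section \<open>Successive rounds and coverage\<close>

lemma descend_to:
  "j = bottom + int k \<Longrightarrow> m \<le> k \<Longrightarrow>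
    \<exists>n'\<ge>n + m. at_label (P (int n) j) 2 1 {} \<leadsto> at_label (P (int n') (j - int m)) 2 1 {}"
proof (induction m)
  case (Suc m)
  then obtain n' where n': "n' \<ge> n + m"
      "at_label (P (int n) j) 2 1 {} \<leadsto> at_label (P (int n') (j - int m)) 2 1 {}"
    by auto
  have "bottom < j - int m"
    using Suc.prems by simp
  then obtain n'' where "n'' > n'"
      "at_label (P (int n') (j - int m)) 2 1 {} \<leadsto> at_label (P (int n'') (j - int m - 1)) 2 1 {}"
    using descend by blast
  then show ?case
    using n' reach_trans by (intro exI[of _ n'']) (auto simp: algebra_simps)
qed auto

text \<open>Descending \<open>k\<close> lines moves the pebble to an index of at least
  \<open>k\<close> on the bottom line. The subsequent climb regains at least these \<open>k\<close>
  lines and \<open>K > 0\<close> more.\<close>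

lemma next_round:
  assumes "bottom \<le> j"
  shows "\<exists>j'>j. at_label (P 0 j) 2 1 {} \<leadsto> at_label (P 0 j') 2 1 {}"
proof -
  define k where "k = nat (j - bottom)"
  have j: "j = bottom + int k"
    using assms by (simp add: k_def)
  obtain n where n: "n \<ge> k" "at_label (P 0 j) 2 1 {} \<leadsto> at_label (P (int n) bottom) 2 1 {}"
    using descend_to[OF j order_refl, of 0] j by auto
  obtain j' where "j' \<ge> bottom + int n + int K"
      "at_label (P (int n) bottom) 0 1 {} \<leadsto> at_label (P 0 j') 2 1 {}"
    using departure[of "int n" bottom] by auto
  then have "at_label (P 0 j) 2 1 {} \<leadsto> at_label (P 0 j') 2 1 {}" "j' > j"
    using n j K_pos restart reach_trans by (blast, simp)
  then show ?thesis
    by blast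
qed

lemma late_round:
  assumes "0 \<le> i" and "bottom \<le> j + int K"
  shows "\<exists>j'\<ge>bottom + int t. at_label (P i j) 0 1 {} \<leadsto> at_label (P 0 j') 2 1 {}"
proof (induction t)
  case 0
  obtain j' where "j' \<ge> j + i + int K" "at_label (P i j) 0 1 {} \<leadsto> at_label (P 0 j') 2 1 {}"
    using departure[of i j 1 "{}"] assms by auto
  then show ?case
    using assms by (intro exI[of _ j']) auto
next
  case (Suc t)
  then obtain j' where j': "j' \<ge> bottom + int t" "at_label (P i j) 0 1 {} \<leadsto> at_label (P 0 j') 2 1 {}"
    by blast
  obtain j'' where "j'' > j'" "at_label (P 0 j') 2 1 {} \<leadsto> at_label (P 0 j'') 2 1 {}"
    using next_round[of j'] j' by auto
  then show ?case
    using j' reach_trans by (intro exI[of _ j'']) auto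
qed

lemma initial_at_label: "initial_config c (machine pr) u = at_label u 0 c {}"
  by (simp add: initial_config_def conf_def machine_def)

lemma scan_visits:
  assumes "0 \<le> i" and "bottom \<le> j + int K" and "0 \<le> i'" and "bottom \<le> j'"
  shows "visits (initial_config 1 (machine pr) (P i j)) (P i' j')"
proof -
  \<comment> \<open>A round that starts on line \<open>i' + j'\<close> or higher descends at least
    \<open>i'\<close> lines before line \<open>j'\<close>; by then the pebble has index at least
    \<open>i'\<close>, and the walk from it to the wall passes the target.\<close>
  obtain j0 where j0: "j0 \<ge> bottom + int (nat (i' + j' - bottom))"
      "at_label (P i j) 0 1 {} \<leadsto> at_label (P 0 j0) 2 1 {}"
    using late_round[OF assms(1,2)] by blast
  define m where "m = nat (j0 - j')"
  have m: "j0 = bottom + int (nat (j0 - bottom))" "m \<le> nat (j0 - bottom)" "j0 - int m = j'" "i' \<le> int m"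
    using j0 assms m_def by auto
  obtain n where n: "n \<ge> m" "at_label (P 0 j0) 2 1 {} \<leadsto> at_label (P (int n) j') 2 1 {}"
    using descend_to[OF m(1,2), of 0] m(3) by auto
  have "visits (at_label (P (int n) j') 2 1 {}) (P i' j')"
    using line_visits[of "nat i'" n j'] n(1) m(4) assms(3) by simp
  then show ?thesis
    using j0(2) n(2) visits_later initial_at_label by metis
qed

text \<open>Every round includes the tour, so the first one suffices.\<close>

lemma scan_visits_tour:
  assumes "0 \<le> i" and "bottom \<le> j + int K" and "v \<in> nodes_on (P 0 bottom) tour"
  shows "visits (initial_config 1 (machine pr) (P i j)) v"
proof -
  obtain j0 where j0: "j0 \<ge> bottom + int 0"
      "at_label (P i j) 0 1 {} \<leadsto> at_label (P 0 j0) 2 1 {}"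
    using late_round[OF assms(1,2)] by blast
  have m: "j0 = bottom + int (nat (j0 - bottom))"
    using j0 by simp
  obtain n where n: "at_label (P 0 j0) 2 1 {} \<leadsto> at_label (P (int n) bottom) 2 1 {}"
    using descend_to[OF m order_refl, of 0] j0 by auto
  then show ?thesis
    using j0(2) tour_visits[OF assms(3)] visits_later initial_at_label by metis
qed

end

section \<open>Two affine coordinates on the grid\<close>

definition leg_x :: "int \<Rightarrow> port list" where
  "leg_x n = replicate (nat \<bar>n\<bar>) (if n \<ge> 0 then East else West)"

definition leg_y :: "int \<Rightarrow> port list" where
  "leg_y n = replicate (nat \<bar>n\<bar>) (if n \<ge> 0 then North else South)"

lemma walk_replicate:
  "walk u (replicate n East) = u + (int n, 0)"
  "walk u (replicate n West) = u - (int n, 0)"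
  "walk u (replicate n North) = u + (0, int n)"
  "walk u (replicate n South) = u - (0, int n)"
proof -
  have "walk (x, y) (replicate n East) = (x + int n, y)" "walk (x, y) (replicate n West) = (x - int n, y)"
    "walk (x, y) (replicate n North) = (x, y + int n)" "walk (x, y) (replicate n South) = (x, y - int n)" for x y
    by (induction n arbitrary: x y) simp_all
  then show "walk u (replicate n East) = u + (int n, 0)" "walk u (replicate n West) = u - (int n, 0)"
    "walk u (replicate n North) = u + (0, int n)" "walk u (replicate n South) = u - (0, int n)"
    by (cases u; simp)+
qed

lemma walk_leg: "walk u (leg_x n) = u + (n, 0)" "walk u (leg_y n) = u + (0, n)"
  by (cases u; simp add: leg_x_def leg_y_def walk_replicate)+

text \<open>The wall lies on the line \<open>b = 0\<close> and the second half-line on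
  \<open>a = 0\<close>; \<open>la\<close> and \<open>lb\<close> are the linear parts of these affine
  forms. Apart from symmetry, the status of all edges outside the three listed kinds, in particular
  around the corner, is left open.\<close>

locale wall_grid =
  fixes F :: "node \<Rightarrow> port set" and a0 a1 a2 b0 b1 b2 :: real
    and la lb a b :: "node \<Rightarrow> real"
  assumes la_def: "la u = a1 * of_int (fst u) + a2 * of_int (snd u)"
    and lb_def: "lb u = b1 * of_int (fst u) + b2 * of_int (snd u)"
    and a_def: "a u = a0 + la u"
    and b_def: "b u = b0 + lb u"
    and independent: "a1 * b2 - a2 * b1 \<noteq> 0"
    and sym: "sym_ports F"
    and inside: "0 \<le> b u \<Longrightarrow> 0 \<le> b (neighbour u p) \<Longrightarrow> p \<in> F u"
    and wall: "0 < a u \<Longrightarrow> 0 < a (neighbour u p) \<Longrightarrow> 0 \<le> b u \<Longrightarrow> b (neighbour u p) < 0 \<Longrightarrow> p \<notin> F u"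
    and beyond: "a u < 0 \<Longrightarrow> a (neighbour u p) < 0 \<Longrightarrow> p \<in> F u"
begin

lemma linear: "la (u + v) = la u + la v" "lb (u + v) = lb u + lb v"
    "la (u - v) = la u - la v" "lb (u - v) = lb u - lb v"
    "la (- u) = - la u" "lb (- u) = - lb u"
  by (simp_all add: la_def lb_def algebra_simps)

lemma affine: "a (u + v) = a u + la v" "b (u + v) = b u + lb v"
    "a (u - v) = a u - la v" "b (u - v) = b u - lb v"
  by (simp_all add: a_def b_def linear)

(* The leg along which b increases comes first, so that b is minimal at an end of the path. *)
definition path :: "node \<Rightarrow> port list" where
  "path v = (if b2 * of_int (snd v) \<le> b1 * of_int (fst v) then leg_x (fst v) @ leg_y (snd v)
     else leg_y (snd v) @ leg_x (fst v))"

lemma walk_path [simp]: "walk u (path v) = u + v"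
  by (cases u; cases v) (simp add: path_def walk_leg)

text \<open>Each step of a straight leg changes \<open>b\<close> by the same amount, so
  \<open>b\<close> is monotone along the leg.\<close>

lemma nodes_on_replicate_ge:
  "x \<in> nodes_on u (replicate n p) \<Longrightarrow> min (b u) (b (walk u (replicate n p))) \<le> b x"
proof (induction n arbitrary: u)
  case (Suc n)
  define t where "t = b (neighbour u p) - b u"
  have t: "b (neighbour v p) = b v + t" for v
    by (cases u; cases v; cases p) (auto simp: t_def b_def lb_def algebra_simps)
  have b: "b (walk v (replicate k p)) = b v + k * t" for v k
    by (induction k arbitrary: v) (auto simp: t algebra_simps)
  show ?case
  proof (cases "x = u")
    case False
    then have "x \<in> nodes_on (neighbour u p) (replicate n p)"
      using Suc.prems by simp
    from Suc.IH[OF this] have "min (b u + t) (b u + t + n * t) \<le> b x"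
      by (simp add: b t)
    moreover have "min (b u) (b u + t + n * t) \<le> min (b u + t) (b u + t + n * t)"
    proof (cases "t \<ge> 0")
      case False
      then have "real n * t \<le> 0"
        by (simp add: mult_nonneg_nonpos)
      then show ?thesis by auto
    qed auto
    ultimately show ?thesis
      by (simp add: b t)
  qed simp
qed simp

lemma nodes_on_leg_ge:
  "x \<in> nodes_on u (leg_x n) \<Longrightarrow> min (b u) (b (u + (n, 0))) \<le> b x"
  "x \<in> nodes_on u (leg_y n) \<Longrightarrow> min (b u) (b (u + (0, n))) \<le> b x"
  using nodes_on_replicate_ge[of x u] walk_leg[of u n] unfolding leg_x_def leg_y_def by metis+

text \<open>The corner of the path is not below both ends: if the first leg decreases
  \<open>b\<close>, then so does the second, and the final node is lower still.\<close>

lemma nodes_on_path_ge: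
  assumes "x \<in> nodes_on u (path v)"
  shows "min (b u) (b (u + v)) \<le> b x"
proof -
  obtain m n where v: "v = (m, n)"
    by (cases v)
  have uv: "u + (m, 0) + (0, n) = u + v" "u + (0, n) + (m, 0) = u + v"
    by (simp_all add: v add.assoc)
  show ?thesis
  proof (cases "b2 * of_int n \<le> b1 * of_int m")
    case True
    then have "x \<in> nodes_on u (leg_x m) \<or> x \<in> nodes_on (u + (m, 0)) (leg_y n)"
      using assms by (simp add: v path_def walk_leg)
    then have "min (b u) (b (u + (m, 0))) \<le> b x \<or> min (b (u + (m, 0))) (b (u + v)) \<le> b x"
      using nodes_on_leg_ge(1)[of x u m] nodes_on_leg_ge(2)[of x "u + (m, 0)" n] uv by metis
    then show ?thesis
      using True by (auto simp: affine(2) lb_def v)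
  next
    case False
    then have "x \<in> nodes_on u (leg_y n) \<or> x \<in> nodes_on (u + (0, n)) (leg_x m)"
      using assms by (simp add: v path_def walk_leg)
    then have "min (b u) (b (u + (0, n))) \<le> b x \<or> min (b (u + (0, n))) (b (u + v)) \<le> b x"
      using nodes_on_leg_ge(2)[of x u n] nodes_on_leg_ge(1)[of x "u + (0, n)" m] uv by metis
    then show ?thesis
      using False by (auto simp: affine(2) lb_def v)
  qed
qed

text \<open>One step changes \<open>a\<close> by at most
  \<open>\<bar>a1\<bar> + \<bar>a2\<bar>\<close>. Thus a fixed path that starts far enough from the
  line \<open>a = 0\<close> stays on one side of it.\<close>

lemma nodes_on_bounded: "x \<in> nodes_on u ps \<Longrightarrow> \<bar>a x - a u\<bar> \<le> length ps * (\<bar>a1\<bar> + \<bar>a2\<bar>)"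
proof (induction ps arbitrary: u)
  case (Cons p ps)
  have "\<bar>a (neighbour u p) - a u\<bar> \<le> \<bar>a1\<bar> + \<bar>a2\<bar>"
    by (cases u; cases p) (auto simp: a_def la_def algebra_simps)
  moreover have "x = u \<or> \<bar>a x - a (neighbour u p)\<bar> \<le> length ps * (\<bar>a1\<bar> + \<bar>a2\<bar>)"
    using Cons.IH[of "neighbour u p"] Cons.prems by auto
  moreover have "0 \<le> length ps * (\<bar>a1\<bar> + \<bar>a2\<bar>)"
    by simp
  ultimately show ?case
    using abs_triangle_ineq[of "a x - a (neighbour u p)" "a (neighbour u p) - a u"]
    by (auto simp: distrib_right)
qed simp

section \<open>Free paths and the sides of the wall\<close>

lemma pfree_inside: "(\<And>x. x \<in> nodes_on u ps \<Longrightarrow> 0 \<le> b x) \<Longrightarrow> pfree F u ps"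
proof (induction ps arbitrary: u)
  case (Cons p ps)
  then show ?case
    using inside[of u p] Cons.prems[of u] Cons.prems[of "neighbour u p"] by simp
qed simp

lemma pfree_beyond: "(\<And>x. x \<in> nodes_on u ps \<Longrightarrow> a x < 0) \<Longrightarrow> pfree F u ps"
proof (induction ps arbitrary: u)
  case (Cons p ps)
  then show ?case
    using beyond[of u p] Cons.prems[of u] Cons.prems[of "neighbour u p"] by simp
qed simp

text \<open>Where \<open>a\<close> is positive, passing to negative \<open>b\<close> means crossing
  the wall.\<close>

lemma pfree_stays_inside:
  "pfree F u ps \<Longrightarrow> 0 \<le> b u \<Longrightarrow> (\<And>x. x \<in> nodes_on u ps \<Longrightarrow> 0 < a x) \<Longrightarrow> 0 \<le> b (walk u ps)"
proof (induction ps arbitrary: u)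
  case (Cons p ps)
  then have "0 \<le> b (neighbour u p)"
    using wall[of u p] Cons.prems(3)[of u] Cons.prems(3)[of "neighbour u p"] by fastforce
  then show ?case
    using Cons by simp
qed simp

lemma path_free: "0 \<le> b u \<Longrightarrow> 0 \<le> b (u + v) \<Longrightarrow> pfree F u (path v)"
proof (rule pfree_inside)
  fix x assume "0 \<le> b u" "0 \<le> b (u + v)" "x \<in> nodes_on u (path v)"
  then show "0 \<le> b x"
    using nodes_on_path_ge[of x u v] by linarith
qed

text \<open>For each node of \<open>V\<close> a round trip from \<open>w\<close> is appended; it is
  free because both of its ends have nonnegative \<open>b\<close>.\<close>

lemma exists_tour:
  assumes "finite V" and "\<And>x. x \<in> V \<Longrightarrow> 0 \<le> b x" and "0 \<le> b w"
  shows "\<exists>ps. pfree F w ps \<and> walk w ps = w \<and> V \<subseteq> nodes_on w ps"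
  using assms(1,2)
proof (induction V)
  case empty
  show ?case
    by (rule exI[of _ "[]"]) simp
next
  case (insert x V)
  then obtain ps where ps: "pfree F w ps" "walk w ps = w" "V \<subseteq> nodes_on w ps"
    by auto
  define qs where "qs = path (x - w)"
  have w: "walk w qs = x"
    by (simp add: qs_def)
  then have "walk x (backtrack qs) = w"
    by (metis walk_backtrack)
  moreover have "pfree F w qs"
    unfolding qs_def using insert.prems assms(3) by (intro path_free) auto
  moreover from this have "pfree F x (backtrack qs)"
    using pfree_backtrack[OF sym] w by metis
  moreover have "x \<in> nodes_on w qs"
    using end_in_nodes_on[of w qs] w by simp
  ultimately show ?case
    using ps w by (intro exI[of _ "ps @ qs @ backtrack qs"]) auto
qed

section \<open>A basis of the grid adapted to the wedge\<close>

lemma exists_direction: "\<exists>v. la v < 0 \<and> 0 < lb v"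
proof -
  define D where "D = a1 * b2 - a2 * b1"
  \<comment> \<open>Cramer's rule for the real vector on which the two linear forms take the values
    -1 and 1.\<close>
  define x where "x = - (a2 + b2) / D"
  define y where "y = (a1 + b1) / D"
  have D: "D \<noteq> 0"
    using independent by (simp add: D_def)
  have "a1 * x + a2 * y = (a2 * b1 - a1 * b2) / D" "b1 * x + b2 * y = (a1 * b2 - a2 * b1) / D"
    by (simp_all add: x_def y_def add_divide_distrib diff_divide_distrib algebra_simps)
  moreover have "a2 * b1 - a1 * b2 = - D"
    by (simp add: D_def)
  moreover have "a1 * b2 - a2 * b1 = D"
    by (simp add: D_def)
  ultimately have ab: "a1 * x + a2 * y = - 1" "b1 * x + b2 * y = 1"
    using D by (simp_all only: minus_divide_left[symmetric] divide_self not_False_eq_True)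
  \<comment> \<open>After scaling by \<open>n\<close>, the values are \<open>- n\<close> and
    \<open>n\<close>, which exceed the error from rounding to integers in absolute value.\<close>
  define n where "n = \<bar>a1\<bar> + \<bar>a2\<bar> + \<bar>b1\<bar> + \<bar>b2\<bar> + 1"
  define v where "v = (\<lfloor>n * x\<rfloor>, \<lfloor>n * y\<rfloor>)"
  have *: "\<bar>c1 * of_int (fst v) + c2 * of_int (snd v) - n * (c1 * x + c2 * y)\<bar> \<le> \<bar>c1\<bar> + \<bar>c2\<bar>" for c1 c2
  proof -
    have "\<bar>of_int (fst v) - n * x\<bar> \<le> 1" "\<bar>of_int (snd v) - n * y\<bar> \<le> 1"
      unfolding v_def fst_conv snd_conv by linarith+
    then have "\<bar>c1\<bar> * \<bar>of_int (fst v) - n * x\<bar> + \<bar>c2\<bar> * \<bar>of_int (snd v) - n * y\<bar> \<le> \<bar>c1\<bar> * 1 + \<bar>c2\<bar> * 1"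
      by (intro add_mono mult_left_mono) auto
    moreover have "c1 * of_int (fst v) + c2 * of_int (snd v) - n * (c1 * x + c2 * y)
        = c1 * (of_int (fst v) - n * x) + c2 * (of_int (snd v) - n * y)"
      by (simp add: algebra_simps)
    ultimately show ?thesis
      using abs_triangle_ineq[of "c1 * (of_int (fst v) - n * x)" "c2 * (of_int (snd v) - n * y)"]
      by (simp add: abs_mult)
  qed
  have "la v < 0"
    using abs_le_D1[OF *[of a1 a2]] abs_ge_zero[of b1] abs_ge_zero[of b2]
    unfolding la_def ab n_def mult_minus1_right by linarith
  moreover have "0 < lb v"
    using abs_le_D2[OF *[of b1 b2]] abs_ge_zero[of a1] abs_ge_zero[of a2]
    unfolding lb_def ab n_def mult_1_right by linarith
  ultimately show ?thesis by blast
qed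

text \<open>Provides \<open>e = (p, q)\<close> and \<open>f = (r, s)\<close>. The determinant makes
  them a basis of the grid, the bounds on \<open>lb (r, s)\<close> limit the shift of indices
  between lines to one, and the last inequality orients the numbering of the lines.\<close>

lemma exists_frame:
  "\<exists>p q r s. la (p, q) < 0 \<and> 0 < lb (p, q) \<and> (p * s - q * r = 1 \<or> p * s - q * r = - 1) \<and>
     - lb (p, q) \<le> lb (r, s) \<and> lb (r, s) < 0 \<and>
     0 < lb (p, q) * la (r, s) - la (p, q) * lb (r, s)"
proof -
  obtain v where v: "la v < 0" "0 < lb v"
    using exists_direction by blast
  define g where "g = gcd (fst v) (snd v)"
  have "v \<noteq> (0, 0)"
    using v by (auto simp: la_def)
  then have g: "g > 0"
    by (cases v) (auto simp: g_def)
  define p q where "p = fst v div g" and "q = snd v div g"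
  have vg: "fst v = p * g" "snd v = q * g"
    by (simp_all add: p_def q_def g_def)
  have "la v = la (p, q) * g" "lb v = lb (p, q) * g"
    by (simp_all add: la_def lb_def vg algebra_simps)
  then have pq: "la (p, q) < 0" "0 < lb (p, q)"
    using v g by (simp_all add: mult_less_0_iff zero_less_mult_iff)
  have "coprime p q"
    unfolding p_def q_def g_def using \<open>v \<noteq> (0, 0)\<close> by (intro div_gcd_coprime) (cases v; auto)
  then obtain r0 s0 where "r0 * p + s0 * q = 1"
    using bezout_int[of p q] by (metis coprime_imp_gcd_eq_1)
  \<comment> \<open>An alternating form evaluated at two vectors of determinant 1; up to sign it is
    the determinant of the two linear forms, hence nonzero.\<close>
  define k0 where "k0 = lb (p, q) * la (- s0, r0) - la (p, q) * lb (- s0, r0)"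
  have "k0 = - (a1 * b2 - a2 * b1) * (r0 * p + s0 * q)"
    by (simp add: k0_def la_def lb_def algebra_simps)
  then have "k0 \<noteq> 0"
    using independent \<open>r0 * p + s0 * q = 1\<close>
    by (metis mult.right_neutral neg_equal_0_iff_equal of_int_1)
  define \<sigma> :: int where "\<sigma> = (if k0 > 0 then 1 else - 1)"
  define r1 s1 where "r1 = - \<sigma> * s0" and "s1 = \<sigma> * r0"
  have "p * s1 - q * r1 = \<sigma>"
    using \<open>r0 * p + s0 * q = 1\<close> unfolding r1_def s1_def by algebra
  moreover have "lb (p, q) * la (r1, s1) - la (p, q) * lb (r1, s1) = \<sigma> * k0"
    by (simp add: r1_def s1_def k0_def la_def lb_def algebra_simps)
  ultimately have rs1: "p * s1 - q * r1 = 1 \<or> p * s1 - q * r1 = - 1"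
      "0 < lb (p, q) * la (r1, s1) - la (p, q) * lb (r1, s1)"
    using \<open>k0 \<noteq> 0\<close> by (auto simp: \<sigma>_def)
  \<comment> \<open>Subtracting a multiple of \<open>(p, q)\<close> preserves the determinant and
    the alternating form. The \<open>+ 1\<close> keeps \<open>lb (r, s)\<close> strictly negative
    even if the quotient is an integer.\<close>
  define k where "k = \<lfloor>lb (r1, s1) / lb (p, q)\<rfloor> + 1"
  define r s where "r = r1 - k * p" and "s = s1 - k * q"
  have det: "p * s - q * r = p * s1 - q * r1"
    by (simp add: r_def s_def algebra_simps)
  have rs: "la (r, s) = la (r1, s1) - k * la (p, q)" "lb (r, s) = lb (r1, s1) - k * lb (p, q)"
    by (simp_all add: r_def s_def la_def lb_def algebra_simps)
  have "lb (r1, s1) / lb (p, q) < k" "k \<le> lb (r1, s1) / lb (p, q) + 1"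
    unfolding k_def by linarith+
  then have "lb (r1, s1) < k * lb (p, q)" "k * lb (p, q) \<le> lb (r1, s1) + lb (p, q)"
    using pq by (simp_all add: field_simps)
  then have "- lb (p, q) \<le> lb (r, s)" "lb (r, s) < 0"
    by (simp_all add: rs)
  moreover have "0 < lb (p, q) * la (r, s) - la (p, q) * lb (r, s)"
    using rs1(2) by (simp add: rs algebra_simps)
  ultimately show ?thesis
    using pq rs1(1) det by metis
qed

end

section \<open>Lines across the wedge\<close>

text \<open>The form \<open>\<beta> * a - la e * b\<close> is constant along \<open>e\<close>, grows
  by \<open>\<kappa>\<close> along \<open>f\<close> and has the value \<open>Y\<close> at the grid
  origin.\<close>

locale wall_frame = wall_grid +
  fixes p q r s :: int and e f :: node and \<beta> \<kappa> Y :: real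
  assumes e_def: "e = (p, q)" and f_def: "f = (r, s)"
    and beta_def: "\<beta> = lb e" and kappa_def: "\<kappa> = lb e * la f - la e * lb f"
    and Y_def: "Y = lb e * a0 - la e * b0"
    and la_e: "la e < 0" and beta_pos: "0 < \<beta>"
    and det: "p * s - q * r = 1 \<or> p * s - q * r = - 1"
    and lb_f: "- \<beta> \<le> lb f" "lb f < 0"
    and kappa_pos: "0 < \<kappa>"
begin

text \<open>The least multiple of \<open>e\<close> that, added to \<open>j\<close> times
  \<open>f\<close>, gives a node with nonnegative \<open>b\<close>; index 0 thus belongs to the
  first node on the inner side of the wall's line.\<close>

definition base :: "int \<Rightarrow> int" where
  "base j = \<lceil>(- b0 - j * lb f) / \<beta>\<rceil>"

(* The node with number i, counted from the wall, on the j-th line of direction e. *)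
definition P :: "int \<Rightarrow> int \<Rightarrow> node" where
  "P i j = (j * r + (i + base j) * p, j * s + (i + base j) * q)"

definition shift :: "int \<Rightarrow> int" where
  "shift j = base j - base (j + 1)"

lemma b_P: "b (P i j) = b0 + j * lb f + (i + base j) * \<beta>"
  unfolding P_def by (simp add: b_def lb_def beta_def e_def f_def algebra_simps)

lemma b_P_bounds: "of_int i * \<beta> \<le> b (P i j)" "b (P i j) < of_int (i + 1) * \<beta>"
proof -
  have "(- b0 - j * lb f) / \<beta> \<le> base j" "base j < (- b0 - j * lb f) / \<beta> + 1"
    unfolding base_def by linarith+
  then have "- b0 - j * lb f \<le> base j * \<beta>" "base j * \<beta> < - b0 - j * lb f + \<beta>"
    using beta_pos by (simp_all add: field_simps)
  then show "of_int i * \<beta> \<le> b (P i j)" "b (P i j) < of_int (i + 1) * \<beta>"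
    by (simp_all add: b_P algebra_simps)
qed

lemma b_P_nonneg: "0 \<le> b (P i j) \<longleftrightarrow> 0 \<le> i"
proof
  assume "0 \<le> b (P i j)"
  then have "0 < of_int (i + 1) * \<beta>"
    using b_P_bounds(2)[of i j] by linarith
  then have "0 < real_of_int (i + 1)"
    using beta_pos by (simp add: zero_less_mult_iff)
  then show "0 \<le> i" by linarith
next
  assume "0 \<le> i"
  then have "0 \<le> of_int i * \<beta>"
    using beta_pos by simp
  then show "0 \<le> b (P i j)"
    using b_P_bounds(1)[of i j] by linarith
qed

lemma P_shift: "P i j + e = P (i + 1) j" "P i j - e = P (i - 1) j"
    "P i j + f = P (i + shift j) (j + 1)" "P i (j + 1) - f = P (i - shift j) j"
  unfolding P_def shift_def by (simp_all add: e_def f_def algebra_simps)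

text \<open>Adding \<open>f\<close> lowers \<open>b\<close> by at most \<open>\<beta>\<close>, that
  is, by at most one step along \<open>e\<close>.\<close>

lemma shift_range: "shift j = 0 \<or> shift j = - 1"
proof -
  define x where "x = (- b0 - j * lb f) / \<beta>"
  define y where "y = - lb f / \<beta>"
  have y: "0 < y" "y \<le> 1"
    using lb_f beta_pos by (simp_all add: y_def field_simps)
  have "(- b0 - (j + 1) * lb f) / \<beta> = x + y"
    by (simp add: x_def y_def add_divide_distrib diff_divide_distrib algebra_simps)
  then have "base (j + 1) = \<lceil>x + y\<rceil>" "base j = \<lceil>x\<rceil>"
    by (simp_all add: base_def x_def)
  then have "base j \<le> base (j + 1)" "base (j + 1) \<le> base j + 1"
    using y by linarith+
  then show ?thesis
    by (auto simp: shift_def)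
qed

(* The left-hand side is the affine form that is constant on the lines of direction e. *)
lemma line_level: "\<beta> * a (P i j) - la e * b (P i j) = Y + \<kappa> * j"
  unfolding P_def
  by (simp add: a_def b_def la_def lb_def Y_def kappa_def beta_def e_def f_def algebra_simps)

lemma P_inj:
  assumes "P i j = P i' j"
  shows "i = i'"
proof -
  have "of_int (i + base j) * \<beta> = of_int (i' + base j) * \<beta>"
    using assms b_P[of i j] b_P[of i' j] by (metis add_left_cancel)
  then show ?thesis
    using beta_pos mult_right_cancel[of \<beta>] by force
qed

text \<open>Cramer's rule yields integral coordinates, since the determinant
  \<open>\<epsilon>\<close> is 1 or -1 and so its own inverse.\<close>

lemma P_surj: "\<exists>i j. v = P i j"
proof -
  obtain x y where v: "v = (x, y)"
    by (cases v)
  define \<epsilon> where "\<epsilon> = p * s - q * r"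
  have \<epsilon>: "\<epsilon> * \<epsilon> = 1"
    using det by (auto simp: \<epsilon>_def)
  define j where "j = \<epsilon> * (p * y - q * x)"
  define i where "i = \<epsilon> * (x * s - y * r)"
  have "j * r + i * p = \<epsilon> * \<epsilon> * x" "j * s + i * q = \<epsilon> * \<epsilon> * y"
    by (simp_all add: i_def j_def \<epsilon>_def algebra_simps)
  then have "v = P (i - base j) j"
    by (simp add: v P_def \<epsilon>)
  then show ?thesis by blast
qed

text \<open>The first node of a line has \<open>b\<close> between 0 and \<open>\<beta>\<close>, so
  up to a bounded error its \<open>a\<close> grows linearly with \<open>j\<close>.\<close>

lemma level_bounds: "Y + \<kappa> * j + la e * \<beta> \<le> \<beta> * a (P 0 j)" "\<beta> * a (P 0 j) \<le> Y + \<kappa> * j"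
proof -
  have "0 \<le> b (P 0 j)" "b (P 0 j) \<le> \<beta>"
    using b_P_bounds[of 0 j] by simp_all
  then have "la e * \<beta> \<le> la e * b (P 0 j)" "la e * b (P 0 j) \<le> 0"
    using la_e by (simp_all add: mult_le_cancel_left mult_nonpos_nonneg)
  then show "Y + \<kappa> * j + la e * \<beta> \<le> \<beta> * a (P 0 j)" "\<beta> * a (P 0 j) \<le> Y + \<kappa> * j"
    using line_level[of 0 j] by linarith+
qed

text \<open>On high lines the path starts with \<open>a\<close> too large to become nonpositive
  within its length, so it meets nothing but the wall when it tries to reach negative
  \<open>b\<close>.\<close>

lemma wall_blocks:
  "\<exists>J. \<forall>j\<ge>J. pfree F (P 0 j) ps \<longrightarrow> 0 \<le> b (walk (P 0 j) ps)"
proof -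
  define C where "C = length ps * (\<bar>a1\<bar> + \<bar>a2\<bar>)"
  define J where "J = \<lfloor>(\<beta> * C - la e * \<beta> - Y) / \<kappa>\<rfloor> + 1"
  have "0 \<le> b (walk (P 0 j) ps)" if "J \<le> j" "pfree F (P 0 j) ps" for j
  proof (rule pfree_stays_inside[OF that(2)])
    show "0 \<le> b (P 0 j)"
      by (simp add: b_P_nonneg)
    have "(\<beta> * C - la e * \<beta> - Y) / \<kappa> < j"
      using that(1) unfolding J_def by linarith
    then have "\<beta> * C < \<beta> * a (P 0 j)"
      using level_bounds(1)[of j] kappa_pos by (simp add: field_simps)
    then have "C < a (P 0 j)"
      using beta_pos by simp
    then show "0 < a x" if "x \<in> nodes_on (P 0 j) ps" for x
      using nodes_on_bounded[OF that] unfolding C_def by linarith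
  qed
  then show ?thesis by blast
qed

text \<open>Far down, the whole path stays where \<open>a\<close> is negative, beyond the end of the
  wall.\<close>

lemma free_below: "\<exists>j. \<forall>x\<in>nodes_on (P 0 j) ps. a x < 0"
proof -
  define C where "C = length ps * (\<bar>a1\<bar> + \<bar>a2\<bar>)"
  define j where "j = \<lceil>(- \<beta> * C - Y) / \<kappa>\<rceil> - 1"
  have "j < (- \<beta> * C - Y) / \<kappa>"
    unfolding j_def by linarith
  then have "\<beta> * a (P 0 j) < \<beta> * (- C)"
    using level_bounds(2)[of j] kappa_pos by (simp add: field_simps)
  then have "a (P 0 j) < - C"
    using beta_pos by (simp only: mult_less_cancel_left_pos)
  then have "a x < 0" if "x \<in> nodes_on (P 0 j) ps" for x
    using nodes_on_bounded[OF that] unfolding C_def by linarith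
  then show ?thesis by blast
qed

lemma exists_probe:
  "\<exists>probe bottom. J \<le> bottom \<and> (\<forall>j\<ge>bottom. pfree F (P 0 j) probe \<longleftrightarrow> j = bottom)"
proof -
  define in2 where "in2 = path (- e) @ path (- e)"
  obtain l where l: "\<forall>x\<in>nodes_on (P 0 l) in2. a x < 0"
    using free_below by blast
  (* The path from the wall on line J goes round the end of the wall to a line that meets only the
     prolongation of the wall, and crosses this prolongation there. *)
  define probe where "probe = path (P 0 l - P 0 J) @ in2"
  have walk: "walk (P 0 j) probe = P 0 j + (P 0 l - P 0 J) - e - e" for j
    by (simp add: probe_def in2_def)
  have free: "pfree F (P 0 J) probe"
    using l by (auto simp: probe_def b_P_nonneg intro: path_free pfree_beyond)
  \<comment> \<open>First nodes of lines have \<open>b\<close> in the interval from 0 to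
    \<open>\<beta>\<close>, excluding \<open>\<beta>\<close>; the two final steps against
    \<open>e\<close> therefore outweigh the values on lines \<open>j\<close> and
    \<open>l\<close>.\<close>
  have end_neg: "b (walk (P 0 j) probe) < 0" for j
  proof -
    have "b (walk (P 0 j) probe) = b (P 0 j) + (lb (P 0 l) - lb (P 0 J)) - lb e - lb e"
      by (simp only: walk affine linear)
    then have "b (walk (P 0 j) probe) = b (P 0 j) + (b (P 0 l) - b (P 0 J)) - 2 * \<beta>"
      using b_def[of "P 0 l"] b_def[of "P 0 J"] beta_def by linarith
    then show ?thesis
      using b_P_bounds[of 0 j] b_P_bounds[of 0 l] b_P_bounds[of 0 J] by simp
  qed
  obtain J' where J': "\<forall>j\<ge>J'. pfree F (P 0 j) probe \<longrightarrow> 0 \<le> b (walk (P 0 j) probe)"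
    using wall_blocks by blast
  \<comment> \<open>On these lines the probe succeeds. Line \<open>J\<close> is one of them and none
    lies at or above \<open>J'\<close>, so there is a highest one.\<close>
  define L where "L = {j. J \<le> j \<and> pfree F (P 0 j) probe}"
  have sub: "L \<subseteq> {J..J'}"
  proof
    fix j assume "j \<in> L"
    then have "J \<le> j" "\<not> J' \<le> j"
      using J' end_neg[of j] unfolding L_def by auto
    then show "j \<in> {J..J'}"
      by simp
  qed
  then have fin: "finite L"
    by (rule finite_subset) simp
  have "J \<in> L"
    using free by (simp add: L_def)
  define bottom where "bottom = Max L"
  have "bottom \<in> L"
    unfolding bottom_def using fin \<open>J \<in> L\<close> by (intro Max_in) auto
  then have in_L: "J \<le> bottom" "pfree F (P 0 bottom) probe"
    by (simp_all add: L_def)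
  have "pfree F (P 0 j) probe \<longleftrightarrow> j = bottom" if "bottom \<le> j" for j
  proof
    assume "pfree F (P 0 j) probe"
    then have "j \<in> L"
      using in_L that by (simp add: L_def)
    then have "j \<le> bottom"
      unfolding bottom_def using fin by simp
    then show "j = bottom"
      using that by simp
  qed (use in_L in simp)
  then show ?thesis
    using in_L(1) by blast
qed

section \<open>Bounds for the lines that meet the wedge\<close>

lemma finite_lower_part: "finite {v. \<exists>i j. v = P i j \<and> j < n \<and> 0 \<le> a v \<and> 0 \<le> b v}"
proof -
  define m where "m = \<lceil>- Y / \<kappa>\<rceil>"
  define k where "k = \<lfloor>(Y + \<kappa> * n) / (- la e * \<beta>)\<rfloor>"
  \<comment> \<open>In the wedge, \<open>\<beta> * a\<close> and \<open>- la e * b\<close> are both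
    nonnegative with sum \<open>Y + \<kappa> * j\<close>. This bounds \<open>j\<close> from below
    and, as \<open>b\<close> is at least \<open>i * \<beta>\<close>, also \<open>i\<close> from
    above.\<close>
  have box: "i \<in> {0..k}" "j \<in> {m..n}" if "j < n" "0 \<le> a (P i j)" "0 \<le> b (P i j)" for i j
  proof -
    have i: "0 \<le> i"
      using that b_P_nonneg by simp
    have "0 \<le> \<beta> * a (P i j)"
      using that(2) beta_pos by simp
    then have "- la e * b (P i j) \<le> Y + \<kappa> * j"
      using line_level[of i j] by simp
    moreover have "- la e * (i * \<beta>) \<le> - la e * b (P i j)"
      using b_P_bounds(1)[of i j] la_e by (intro mult_left_mono) auto
    moreover have "0 \<le> - la e * (i * \<beta>)"
      using i la_e beta_pos by (simp add: mult_nonpos_nonneg)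
    moreover have "\<kappa> * j \<le> \<kappa> * n"
      using that(1) kappa_pos by simp
    ultimately have "0 \<le> Y + \<kappa> * j" "i * (- la e * \<beta>) \<le> Y + \<kappa> * n"
      by (simp_all add: algebra_simps)
    then have "- Y / \<kappa> \<le> j" "i \<le> (Y + \<kappa> * n) / (- la e * \<beta>)"
      using kappa_pos la_e beta_pos
      by (simp add: field_simps, subst pos_le_divide_eq) (auto simp: mult_neg_pos)
    then show "i \<in> {0..k}" "j \<in> {m..n}"
      using i that(1) unfolding m_def k_def by (auto simp: le_floor_iff ceiling_le_iff)
  qed
  have "{v. \<exists>i j. v = P i j \<and> j < n \<and> 0 \<le> a v \<and> 0 \<le> b v} \<subseteq> (\<lambda>(i, j). P i j) ` ({0..k} \<times> {m..n})"
  proof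
    fix v assume "v \<in> {v. \<exists>i j. v = P i j \<and> j < n \<and> 0 \<le> a v \<and> 0 \<le> b v}"
    then obtain i j where v: "v = P i j" "j < n" "0 \<le> a (P i j)" "0 \<le> b (P i j)"
      by blast
    then have "(i, j) \<in> {0..k} \<times> {m..n}"
      using box by blast
    then show "v \<in> (\<lambda>(i, j). P i j) ` ({0..k} \<times> {m..n})"
      using v(1) by (intro image_eqI[of _ _ "(i, j)"]) simp_all
  qed
  then show ?thesis
    by (rule finite_subset) simp
qed

lemma lines_bounded_below: "\<exists>m. \<forall>i j. 0 \<le> a (P i j) \<longrightarrow> 0 \<le> b (P i j) \<longrightarrow> m \<le> j"
proof -
  have "\<lceil>- Y / \<kappa>\<rceil> \<le> j" if "0 \<le> a (P i j)" "0 \<le> b (P i j)" for i j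
  proof -
    have "la e * b (P i j) \<le> 0" "0 \<le> \<beta> * a (P i j)"
      using that la_e beta_pos by (simp_all add: mult_nonpos_nonneg)
    then have "- Y / \<kappa> \<le> j"
      using line_level[of i j] kappa_pos by (simp add: field_simps)
    then show ?thesis
      by (simp add: ceiling_le_iff)
  qed
  then show ?thesis by blast
qed

section \<open>The scanning automaton of a frame\<close>

lemma frame_explorer:
  "\<exists>A :: nat automaton. valid_automaton 1 A \<and> explores F {u. 0 \<le> a u \<and> 0 \<le> b u} 1 A"
proof -
  obtain J1 where J1: "\<forall>j\<ge>J1. pfree F (P 0 j) (path (- e)) \<longrightarrow> 0 \<le> b (walk (P 0 j) (path (- e)))"
    using wall_blocks by blast
  obtain J2 where J2: "\<forall>j\<ge>J2. pfree F (P 0 j) (path f) \<longrightarrow> 0 \<le> b (walk (P 0 j) (path f))"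
    using wall_blocks by blast
  \<comment> \<open>From \<open>max J1 J2\<close> on, the wall stops both the inward path and a
    climb that would pass behind it.\<close>
  obtain probe bottom where probe: "max J1 J2 \<le> bottom"
      "\<forall>j\<ge>bottom. pfree F (P 0 j) probe \<longleftrightarrow> j = bottom"
    using exists_probe by blast
  define V where "V = {v. \<exists>i j. v = P i j \<and> j < bottom \<and> 0 \<le> a v \<and> 0 \<le> b v}"
  obtain tour where tour: "pfree F (P 0 bottom) tour" "walk (P 0 bottom) tour = P 0 bottom"
      "V \<subseteq> nodes_on (P 0 bottom) tour"
    using exists_tour[of V "P 0 bottom"] finite_lower_part[of bottom] b_P_nonneg[of 0 bottom]
    unfolding V_def by blast
  obtain m where m: "\<And>i j. 0 \<le> a (P i j) \<Longrightarrow> 0 \<le> b (P i j) \<Longrightarrow> m \<le> j"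
    using lines_bounded_below by blast
  \<comment> \<open>No node of the wedge lies below line \<open>m\<close>, so \<open>K\<close>
    outward steps suffice from every starting node.\<close>
  define K where "K = nat (bottom - m) + 1"
  \<comment> \<open>As rank serves the integer part of \<open>b\<close> divided by
    \<open>- lb f\<close>: a step along \<open>f\<close> lowers the quotient by exactly one.\<close>
  interpret scan F "path e" "path (- e)" "path f" "path (- f)" probe tour K P shift bottom
    "\<lambda>i j. nat \<lfloor>b (P i j) / (- lb f)\<rfloor>"
  proof
    show "sym_ports F"
      by (rule sym)
    show "P i j = P i' j \<Longrightarrow> i = i'" for i j i'
      by (rule P_inj)
    show "shift j = 0 \<or> shift j = - 1" for j
      by (rule shift_range)
    show "walk (P i j) (path e) = P (i + 1) j" for i j
      by (simp add: P_shift)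
    show "walk (P i j) (path (- e)) = P (i - 1) j" for i j
      by (simp add: P_shift)
    show "walk (P i j) (path f) = P (i + shift j) (j + 1)" for i j
      by (simp add: P_shift)
    show "walk (P i (j + 1)) (path (- f)) = P (i - shift j) j" for i j
      by (simp add: P_shift)
    show "walk (P 0 bottom) tour = P 0 bottom"
      by (rule tour)
    show "path e \<noteq> []"
    proof
      assume "path e = []"
      then have "P 0 0 + e = P 0 0"
        using walk_path[of "P 0 0" e] by simp
      then show False
        using P_inj[of 1 0 0] P_shift(1)[of 0 0] by simp
    qed
    show "pfree F (P i j) (path e)" if "0 \<le> i" for i j
      using that by (intro path_free) (simp_all add: P_shift b_P_nonneg)
    show "pfree F (P i j) (path (- e))" if "1 \<le> i" for i j
      using that by (intro path_free) (simp_all add: P_shift b_P_nonneg)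
    show "\<not> pfree F (P 0 j) (path (- e))" if "bottom \<le> j" for j
    proof
      assume "pfree F (P 0 j) (path (- e))"
      then have "0 \<le> b (P (- 1) j)"
        using J1 that probe(1) by (simp add: P_shift)
      then show False
        by (simp add: b_P_nonneg)
    qed
    show "pfree F (P i j) (path f)" if "0 \<le> i" "0 \<le> i + shift j" for i j
      using that by (intro path_free) (simp_all add: P_shift b_P_nonneg)
    show "\<not> pfree F (P 0 j) (path f)" if "bottom \<le> j" "shift j = - 1" for j
    proof
      assume "pfree F (P 0 j) (path f)"
      then have "0 \<le> b (P (- 1) (j + 1))"
        using J2[rule_format, of j] that probe(1) P_shift(3)[of 0 j] by simp
      then show False
        by (simp add: b_P_nonneg)
    qed
    show "pfree F (P i j) (path (- f))" if "0 \<le> i" for i j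
      using that P_shift(4)[of i "j - 1"] shift_range[of "j - 1"]
      by (intro path_free) (auto simp: b_P_nonneg)
    show "pfree F (P 0 j) probe \<longleftrightarrow> j = bottom" if "bottom \<le> j" for j
      using probe(2) that by simp
    show "pfree F (P 0 bottom) tour"
      by (rule tour)
    show "0 < K"
      by (simp add: K_def)
    show "nat \<lfloor>b (P (i + shift j) (j + 1)) / (- lb f)\<rfloor> < nat \<lfloor>b (P i j) / (- lb f)\<rfloor>"
      if "0 \<le> i" "0 \<le> i + shift j" for i j
    proof -
      define x where "x = b (P (i + shift j) (j + 1)) / (- lb f)"
      have "0 \<le> x"
        using that(2) lb_f(2) b_P_nonneg by (simp add: x_def divide_nonneg_neg)
      have "b (P (i + shift j) (j + 1)) = b (P i j) + lb f"
        by (metis P_shift(3) affine(2))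
      then have "b (P i j) / (- lb f) = x + 1"
        using lb_f(2) by (simp add: x_def field_simps)
      then show ?thesis
        unfolding x_def[symmetric] using \<open>0 \<le> x\<close> by simp
    qed
  qed
  have "explores F {u. 0 \<le> a u \<and> 0 \<le> b u} 1 (machine pr)"
    unfolding explores_def
  proof (intro ballI)
    fix u v assume u: "u \<in> {u. 0 \<le> a u \<and> 0 \<le> b u}" and v: "v \<in> {u. 0 \<le> a u \<and> 0 \<le> b u}"
    obtain i j where ij: "u = P i j"
      using P_surj by blast
    have i: "0 \<le> i" and j: "bottom \<le> j + int K"
      using u m[of i j] b_P_nonneg[of i j] by (auto simp: ij K_def)
    obtain i' j' where ij': "v = P i' j'"
      using P_surj by blast
    have i': "0 \<le> i'"
      using v b_P_nonneg by (simp add: ij')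
    have "visits (initial_config 1 (machine pr) u) v"
    proof (cases "bottom \<le> j'")
      case True
      then show ?thesis
        using scan_visits i j i' ij ij' by simp
    next
      case False
      then have "v \<in> V"
        using v ij' unfolding V_def by (metis (mono_tags, lifting) mem_Collect_eq not_le)
      then show ?thesis
        using scan_visits_tour i j ij tour(3) by blast
    qed
    then show "\<exists>n. pos ((step F (machine pr) ^^ n) (initial_config 1 (machine pr) u)) = v"
      unfolding visits_def reach_def by blast
  qed
  then show ?thesis
    using explores_encode valid_encode valid_scan_prog by blast
qed

end

lemma (in wall_grid) exists_explorer:
  "\<exists>A :: nat automaton. valid_automaton 1 A \<and> explores F {u. 0 \<le> a u \<and> 0 \<le> b u} 1 A"
proof -
  obtain p q r s where *: "la (p, q) < 0" "0 < lb (p, q)" "p * s - q * r = 1 \<or> p * s - q * r = - 1"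
      "- lb (p, q) \<le> lb (r, s)" "lb (r, s) < 0"
      "0 < lb (p, q) * la (r, s) - la (p, q) * lb (r, s)"
    using exists_frame by blast
  interpret wall_frame F a0 a1 a2 b0 b1 b2 la lb a b p q r s "(p, q)" "(r, s)" "lb (p, q)"
    "lb (p, q) * la (r, s) - la (p, q) * lb (r, s)" "lb (p, q) * a0 - la (p, q) * b0"
    by unfold_locales (use * in auto)
  show ?thesis
    by (rule frame_explorer)
qed

section \<open>Wedges in the plane\<close>

definition cross :: "complex \<Rightarrow> complex \<Rightarrow> real" where
  "cross z w = Re z * Im w - Im z * Re w"

lemma clockwise_turn:
  assumes "d1 \<noteq> 0" and "d2 \<noteq> 0"
  shows "d2 = of_real (cmod d2 / cmod d1) * d1 * cis (- clockwise_angle d1 d2)"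
proof -
  have "d1 / d2 = of_real (cmod (d1 / d2)) * cis (clockwise_angle d1 d2)"
    using Arg2pi_eq[of "d1 / d2"] by (simp add: clockwise_angle_def cis_conv_exp)
  then have "d1 * cis (- clockwise_angle d1 d2) = d2 * of_real (cmod (d1 / d2))"
    using assms by (simp add: cis_mult[symmetric] field_simps cis_inverse[symmetric])
  then show ?thesis
    using assms by (simp add: norm_divide field_simps)
qed

text \<open>For an angle strictly between 0 and \<open>pi\<close>, the directions swept clockwise
  are exactly the nonnegative combinations of the two boundary directions.\<close>

lemma wedge_region_cone:
  assumes "d1 \<noteq> 0" and "d2 \<noteq> 0" and "0 < clockwise_angle d1 d2" and "clockwise_angle d1 d2 < pi"
  shows "wedge_region c d1 d2 = {c + of_real x * d1 + of_real y * d2 | x y. 0 \<le> x \<and> 0 \<le> y}"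
    (is "_ = ?cone")
proof
  define \<theta> where "\<theta> = clockwise_angle d1 d2"
  define \<rho> where "\<rho> = cmod d2 / cmod d1"
  have \<rho>: "0 < \<rho>"
    using assms by (simp add: \<rho>_def)
  have \<theta>: "0 < \<theta>" "\<theta> < pi" "0 < sin \<theta>"
    using assms by (simp_all add: \<theta>_def sin_gt_zero)
  have d2: "d2 = of_real \<rho> * d1 * cis (- \<theta>)"
    using clockwise_turn assms by (simp add: \<rho>_def \<theta>_def)
  show "wedge_region c d1 d2 \<subseteq> ?cone"
  proof
    fix z assume "z \<in> wedge_region c d1 d2"
    then obtain \<phi> t where \<phi>: "0 \<le> \<phi>" "\<phi> \<le> \<theta>" and t: "0 \<le> t"
        and z: "z = c + of_real t * (d1 * cis (- \<phi>))"
      by (auto simp: wedge_region_def half_line_def \<theta>_def)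
    define x y where "x = t * sin (\<theta> - \<phi>) / sin \<theta>" and "y = t * sin \<phi> / (\<rho> * sin \<theta>)"
    \<comment> \<open>The sine rule: the intermediate direction is resolved along the two boundary
      directions.\<close>
    have "cis (- \<phi>) = of_real (sin (\<theta> - \<phi>) / sin \<theta>) + of_real (sin \<phi> / sin \<theta>) * cis (- \<theta>)"
      using \<theta>(3) by (simp add: complex_eq_iff sin_diff field_simps)
    then have "of_real t * (d1 * cis (- \<phi>)) = of_real x * d1 + of_real y * d2"
      using \<rho> by (simp add: d2 x_def y_def field_simps)
    moreover have "0 \<le> x" "0 \<le> y"
      using t \<phi> \<theta> \<rho> by (simp_all add: x_def y_def sin_ge_zero)
    ultimately show "z \<in> ?cone"
      using z by (metis (mono_tags, lifting) add.assoc mem_Collect_eq)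
  qed
  show "?cone \<subseteq> wedge_region c d1 d2"
  proof
    fix z assume "z \<in> ?cone"
    then obtain x y where xy: "0 \<le> x" "0 \<le> y" and z: "z = c + of_real x * d1 + of_real y * d2"
      by blast
    \<comment> \<open>The conjugate of \<open>(z - c) / d1\<close>; conjugation turns clockwise
      angles into the counterclockwise ones measured by \<open>Arg2pi\<close>.\<close>
    define w where "w = of_real x + of_real (y * \<rho>) * cis \<theta>"
    define \<phi> where "\<phi> = Arg2pi w"
    have w: "w = of_real (cmod w) * cis \<phi>"
      using Arg2pi_eq[of w] by (simp add: \<phi>_def cis_conv_exp)
    have "0 \<le> Im w"
      using xy \<rho> \<theta> by (simp add: w_def)
    then have \<phi>: "0 \<le> \<phi>" "\<phi> \<le> pi"
      using Arg2pi_ge_0[of w] Arg2pi_le_pi[of w] by (simp_all add: \<phi>_def)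
    have "z = c + d1 * cnj w"
      by (simp add: z w_def d2 cis_cnj algebra_simps)
    also have "cnj w = of_real (cmod w) * cis (- \<phi>)"
      by (metis w complex_cnj_mult complex_cnj_complex_of_real cis_cnj)
    finally have z': "z = c + of_real (cmod w) * (d1 * cis (- \<phi>))"
      by (simp add: algebra_simps)
    \<comment> \<open>An angle beyond \<open>\<theta>\<close> would make
      \<open>x * sin \<theta>\<close> negative.\<close>
    have "w = 0 \<or> \<phi> \<le> \<theta>"
    proof (rule ccontr)
      assume "\<not> (w = 0 \<or> \<phi> \<le> \<theta>)"
      then have "cmod w > 0" "\<theta> - \<phi> < 0" "- pi < \<theta> - \<phi>"
        using \<phi> \<theta> by auto
      then have "cmod w * sin (\<theta> - \<phi>) < 0"
        using sin_gt_zero[of "\<phi> - \<theta>"] sin_minus[of "\<phi> - \<theta>"] by (simp add: mult_pos_neg)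
      moreover have "Im (cis \<theta> * cnj w) = x * sin \<theta>"
        by (simp add: w_def algebra_simps)
      moreover have "Im (cis \<theta> * cnj w) = cmod w * sin (\<theta> - \<phi>)"
        unfolding \<open>cnj w = of_real (cmod w) * cis (- \<phi>)\<close> by (simp add: sin_diff algebra_simps)
      moreover have "0 \<le> x * sin \<theta>"
        using xy \<theta> by simp
      ultimately show False
        by linarith
    qed
    \<comment> \<open>The minimum also covers the apex \<open>w = 0\<close>, which lies on the
      half-line of every angle.\<close>
    then have "z \<in> half_line c (d1 * cis (- min \<phi> \<theta>))"
      using z' unfolding half_line_def by (cases "w = 0") (auto simp: min_def intro: exI[of _ 0])
    then show "z \<in> wedge_region c d1 d2"
      using \<phi> \<theta> unfolding wedge_region_def \<theta>_def[symmetric]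
      by (intro UN_I[of "min \<phi> \<theta>"]) auto
  qed
qed

locale plane_wedge =
  fixes c d1 d2 :: complex and F :: "node \<Rightarrow> port set"
  assumes cross_nonzero: "cross d1 d2 \<noteq> 0"
    and region: "wedge_region c d1 d2 = {c + of_real x * d1 + of_real y * d2 | x y. 0 \<le> x \<and> 0 \<le> y}"
    and semi_walled: "semi_walled c d1 d2 F"
begin

text \<open>Cramer's rule: \<open>A\<close> and \<open>B\<close> are the coordinates with origin
  \<open>c\<close> and basis \<open>d1\<close>, \<open>d2\<close>. Hence the wall lies on
  \<open>B z = 0\<close> and the second half-line on \<open>A z = 0\<close>.\<close>

definition A :: "complex \<Rightarrow> real" where "A z = cross (z - c) d2 / cross d1 d2"
definition B :: "complex \<Rightarrow> real" where "B z = cross d1 (z - c) / cross d1 d2"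

lemma coordinates: "z = c + of_real (A z) * d1 + of_real (B z) * d2"
proof -
  let ?D = "cross d1 d2"
  have "of_real ?D * (z - c) = of_real (cross (z - c) d2) * d1 + of_real (cross d1 (z - c)) * d2"
    by (simp add: complex_eq_iff cross_def algebra_simps)
  then have "z - c = of_real (A z) * d1 + of_real (B z) * d2"
    using cross_nonzero by (simp add: A_def B_def field_simps)
  then show ?thesis
    by (simp add: algebra_simps)
qed

lemma coordinates_unique:
  "A (c + of_real x * d1 + of_real y * d2) = x" "B (c + of_real x * d1 + of_real y * d2) = y"
proof -
  have "cross (of_real x * d1 + of_real y * d2) d2 = x * cross d1 d2"
    "cross d1 (of_real x * d1 + of_real y * d2) = y * cross d1 d2"
    by (simp_all add: cross_def algebra_simps)
  then show "A (c + of_real x * d1 + of_real y * d2) = x" "B (c + of_real x * d1 + of_real y * d2) = y"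
    using cross_nonzero by (simp_all add: A_def B_def add.assoc)
qed

lemma in_region: "z \<in> wedge_region c d1 d2 \<longleftrightarrow> 0 \<le> A z \<and> 0 \<le> B z"
  unfolding region using coordinates coordinates_unique by (smt (verit) mem_Collect_eq)

lemma in_half_line1: "z \<in> half_line c d1 \<longleftrightarrow> 0 \<le> A z \<and> B z = 0"
  using coordinates[of z] coordinates_unique[of _ 0] by (fastforce simp: half_line_def)

lemma in_half_line2: "z \<in> half_line c d2 \<longleftrightarrow> A z = 0 \<and> 0 \<le> B z"
  using coordinates[of z] coordinates_unique[of 0] by (fastforce simp: half_line_def)

lemma segment_coordinates:
  "A ((1 - t) *\<^sub>R z + t *\<^sub>R w) = (1 - t) * A z + t * A w"
  "B ((1 - t) *\<^sub>R z + t *\<^sub>R w) = (1 - t) * B z + t * B w"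
proof -
  have "cross ((1 - t) *\<^sub>R z + t *\<^sub>R w - c) d2 = (1 - t) * cross (z - c) d2 + t * cross (w - c) d2"
    "cross d1 ((1 - t) *\<^sub>R z + t *\<^sub>R w - c) = (1 - t) * cross d1 (z - c) + t * cross d1 (w - c)"
    by (simp_all add: cross_def algebra_simps)
  then show "A ((1 - t) *\<^sub>R z + t *\<^sub>R w) = (1 - t) * A z + t * A w"
    "B ((1 - t) *\<^sub>R z + t *\<^sub>R w) = (1 - t) * B z + t * B w"
    by (simp_all add: A_def B_def add_divide_distrib)
qed

lemma segment_meets_zero:
  fixes x y :: real
  assumes "0 \<le> x" and "y < 0"
  obtains t where "0 \<le> t" and "t \<le> 1" and "(1 - t) * x + t * y = 0"
proof
  show "0 \<le> x / (x - y)" "x / (x - y) \<le> 1" "(1 - x / (x - y)) * x + x / (x - y) * y = 0"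
    using assms by (simp_all add: field_simps)
qed

section \<open>Free and blocked edges in oblique coordinates\<close>

abbreviation "a u \<equiv> A (point u)"
abbreviation "b u \<equiv> B (point u)"

abbreviation "E1 \<equiv> crossing_edges (wedge c d1 d2) (half_line c d1)"
abbreviation "E2 \<equiv> crossing_edges (wedge c d1 d2) (half_line c d2)"

lemma in_wedge: "u \<in> wedge c d1 d2 \<longleftrightarrow> 0 \<le> a u \<and> 0 \<le> b u"
  by (simp add: wedge_def in_region)

lemma free_iff: "p \<in> F u \<longleftrightarrow> {u, neighbour u p} \<notin> E1 - E2"
  using semi_walled unfolding semi_walled_def Let_def is_wall_def is_free_def by blast

lemma crossing_edge_iff:
  "{u, neighbour u p} \<in> crossing_edges V H \<longleftrightarrow>
     (u \<in> V \<longleftrightarrow> neighbour u p \<notin> V) \<and> closed_segment (point u) (point (neighbour u p)) \<inter> H \<noteq> {}"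
    (is "?L \<longleftrightarrow> ?R")
proof
  assume ?L
  then obtain v q where "{u, neighbour u p} = {v, neighbour v q}" "v \<in> V" "neighbour v q \<notin> V"
      "closed_segment (point v) (point (neighbour v q)) \<inter> H \<noteq> {}"
    by (auto simp: crossing_edges_def)
  then show ?R
    by (auto simp: doubleton_eq_iff closed_segment_commute)
next
  assume R: ?R
  show ?L
  proof (cases "u \<in> V")
    case True
    then show ?thesis
      using R unfolding crossing_edges_def by blast
  next
    case False
    moreover have "{u, neighbour u p} = {neighbour u p, neighbour (neighbour u p) (opp p)}"
      by auto
    moreover have "closed_segment (point (neighbour u p)) (point (neighbour (neighbour u p) (opp p))) \<inter> H \<noteq> {}"
      using R by (simp add: closed_segment_commute)
    ultimately show ?thesis
      using R unfolding crossing_edges_def mem_Collect_eq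
      by (intro exI[of _ "neighbour u p"] exI[of _ "opp p"]) simp
  qed
qed

lemma sym_F: "sym_ports F"
  unfolding sym_ports_def free_iff by (simp add: insert_commute)

text \<open>\<open>a\<close> vanishes somewhere on the edge, and \<open>b\<close> is nonnegative
  there as a convex combination.\<close>

lemma leaves_across_second:
  assumes "0 \<le> a u" and "0 \<le> b u" and "a v < 0" and "0 \<le> b v"
  shows "closed_segment (point u) (point v) \<inter> half_line c d2 \<noteq> {}"
proof -
  obtain t where t: "0 \<le> t" "t \<le> 1" "(1 - t) * a u + t * a v = 0"
    using segment_meets_zero assms(1,3) by blast
  then have "0 \<le> (1 - t) * b u + t * b v"
    using assms by simp
  then have "(1 - t) *\<^sub>R point u + t *\<^sub>R point v \<in> half_line c d2"
    using t by (simp add: in_half_line2 segment_coordinates)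
  then show ?thesis
    using t by (auto simp: closed_segment_def)
qed

text \<open>With \<open>b\<close> nonnegative at both ends, an edge leaves the wedge only through
  the second half-line, and such edges are free even if they also touch the first one.\<close>

lemma inside_free:
  assumes "0 \<le> b u" and "0 \<le> b (neighbour u p)"
  shows "p \<in> F u"
proof (cases "u \<in> wedge c d1 d2 \<longleftrightarrow> neighbour u p \<notin> wedge c d1 d2")
  case True
  then have "closed_segment (point u) (point (neighbour u p)) \<inter> half_line c d2 \<noteq> {}"
    using assms leaves_across_second[of u "neighbour u p"] leaves_across_second[of "neighbour u p" u]
    by (auto simp: in_wedge closed_segment_commute)
  then show ?thesis
    using True by (simp add: free_iff crossing_edge_iff)
next
  case False
  then show ?thesis
    by (simp add: free_iff crossing_edge_iff)
qed

text \<open>\<open>a\<close> is positive on the whole edge, which therefore misses the second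
  half-line, while the sign change of \<open>b\<close> makes it meet the first.\<close>

lemma wall_blocked:
  assumes "0 < a u" and "0 < a (neighbour u p)" and "0 \<le> b u" and "b (neighbour u p) < 0"
  shows "p \<notin> F u"
proof -
  let ?v = "neighbour u p"
  have pos: "0 < (1 - t) * a u + t * a ?v" if "0 \<le> t" "t \<le> 1" for t
    using assms(1,2) that
    by (cases "t = 0") (auto intro: add_nonneg_pos)
  obtain t where t: "0 \<le> t" "t \<le> 1" "(1 - t) * b u + t * b ?v = 0"
    using segment_meets_zero assms(3,4) by blast
  then have "(1 - t) *\<^sub>R point u + t *\<^sub>R point ?v \<in> half_line c d1"
    using pos[of t] by (simp add: in_half_line1 segment_coordinates)
  then have "closed_segment (point u) (point ?v) \<inter> half_line c d1 \<noteq> {}"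
    using t by (auto simp: closed_segment_def)
  moreover have "closed_segment (point u) (point ?v) \<inter> half_line c d2 = {}"
    using pos by (force simp: closed_segment_def in_half_line2 segment_coordinates)
  ultimately show ?thesis
    using assms by (simp add: free_iff crossing_edge_iff in_wedge)
qed

lemma beyond_free:
  assumes "a u < 0" and "a (neighbour u p) < 0"
  shows "p \<in> F u"
  using assms by (simp add: free_iff crossing_edge_iff in_wedge)

lemma node_coordinates:
  defines "D \<equiv> cross d1 d2"
  shows "a u = - cross c d2 / D + (Im d2 / D * of_int (fst u) + - Re d2 / D * of_int (snd u))"
    and "b u = - cross d1 c / D + (- Im d1 / D * of_int (fst u) + Re d1 / D * of_int (snd u))"
proof -
  have "cross (point u - c) d2 = - cross c d2 + (Im d2 * of_int (fst u) + - Re d2 * of_int (snd u))"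
    "cross d1 (point u - c) = - cross d1 c + (- Im d1 * of_int (fst u) + Re d1 * of_int (snd u))"
    by (simp_all add: cross_def point_def algebra_simps)
  then show "a u = - cross c d2 / D + (Im d2 / D * of_int (fst u) + - Re d2 / D * of_int (snd u))"
    "b u = - cross d1 c / D + (- Im d1 / D * of_int (fst u) + Re d1 / D * of_int (snd u))"
    by (simp_all add: A_def B_def D_def add_divide_distrib diff_divide_distrib)
qed

lemma wedge_explorer: "\<exists>A :: nat automaton. valid_automaton 1 A \<and> explores F (wedge c d1 d2) 1 A"
proof -
  let ?D = "cross d1 d2"
  have "Im d2 / ?D * (Re d1 / ?D) - - Re d2 / ?D * (- Im d1 / ?D) = 1 / ?D"
    using cross_nonzero by (simp add: field_simps) (simp add: cross_def algebra_simps)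
  then have "Im d2 / ?D * (Re d1 / ?D) - - Re d2 / ?D * (- Im d1 / ?D) \<noteq> 0"
    using cross_nonzero by simp
  then interpret wall_grid F "- cross c d2 / ?D" "Im d2 / ?D" "- Re d2 / ?D"
      "- cross d1 c / ?D" "- Im d1 / ?D" "Re d1 / ?D"
      "\<lambda>u. Im d2 / ?D * of_int (fst u) + - Re d2 / ?D * of_int (snd u)"
      "\<lambda>u. - Im d1 / ?D * of_int (fst u) + Re d1 / ?D * of_int (snd u)" a b
    by unfold_locales (use sym_F inside_free wall_blocked beyond_free node_coordinates in auto)
  have "wedge c d1 d2 = {u. 0 \<le> a u \<and> 0 \<le> b u}"
    using in_wedge by blast
  then show ?thesis
    using exists_explorer by simp
qed

end

theorem theorem2:
  fixes c d1 d2 :: complex and F :: "node \<Rightarrow> port set"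
  assumes "d1 \<noteq> 0" and "d2 \<noteq> 0" and "half_line c d1 \<noteq> half_line c d2"
    and "small_wedge d1 d2"
    and "semi_walled c d1 d2 F"
  shows "\<exists>A :: nat automaton. valid_automaton 1 A \<and> explores F (wedge c d1 d2) 1 A"
proof -
  define \<theta> where "\<theta> = clockwise_angle d1 d2"
  define \<rho> where "\<rho> = cmod d2 / cmod d1"
  have \<rho>: "0 < \<rho>"
    using assms(1,2) by (simp add: \<rho>_def)
  have d2: "d2 = of_real \<rho> * d1 * cis (- \<theta>)"
    using clockwise_turn assms(1,2) by (simp add: \<rho>_def \<theta>_def)
  have "\<theta> \<noteq> 0"
  proof
    assume "\<theta> = 0"
    then have "d2 = of_real \<rho> * d1"
      using d2 by simp
    moreover have "half_line c d1 = half_line c (of_real \<rho> * d1)"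
    proof
      show "half_line c (of_real \<rho> * d1) \<subseteq> half_line c d1"
        using \<rho> by (force simp: half_line_def intro: exI[of _ "_ * \<rho>"])
      show "half_line c d1 \<subseteq> half_line c (of_real \<rho> * d1)"
      proof
        fix z assume "z \<in> half_line c d1"
        then obtain t where "0 \<le> t" "z = c + of_real t * d1"
          by (auto simp: half_line_def)
        then have "0 \<le> t / \<rho>" "z = c + of_real (t / \<rho>) * (of_real \<rho> * d1)"
          using \<rho> by simp_all
        then show "z \<in> half_line c (of_real \<rho> * d1)"
          unfolding half_line_def by blast
      qed
    qed
    ultimately show False
      using assms(3) by simp
  qed
  moreover have "0 \<le> \<theta>"
    by (simp add: \<theta>_def clockwise_angle_def Arg2pi_ge_0)
  ultimately have \<theta>: "0 < \<theta>" "\<theta> < pi"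
    using assms(4) by (simp_all add: small_wedge_def \<theta>_def)
  \<comment> \<open>Product of the lengths and the sine of the angle; the sign is negative because
    the turn is clockwise.\<close>
  have "cross d1 d2 = - \<rho> * (cmod d1)\<^sup>2 * sin \<theta>"
    unfolding d2 cmod_power2 by (simp add: cross_def power2_eq_square algebra_simps)
  then have "cross d1 d2 \<noteq> 0"
    using \<rho> \<theta> assms(1) sin_gt_zero[of \<theta>] by simp
  then interpret plane_wedge c d1 d2 F
    using wedge_region_cone[OF assms(1,2)] \<theta> assms(5)
    by unfold_locales (simp_all add: \<theta>_def)
  show ?thesis
    by (rule wedge_explorer)
qed

end
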